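(* Let $A\cong C_0(\Lambda)$ be a separable commutative $C^*$-algebra with Gelfand spectrum $\Lambda$, and let $\pi\colon A\to B(H)$ and $\pi_0\colon A\to B(H_0)$ be nondegenerate representations on separable Hilbert spaces such that $\pi_0$ is asymptotically contained in $\pi$ via a one-parameter unitary group $\{U_t\}$ on $H_0$ and a bounded operator $W\colon H_0\to H$. Suppose that Assumptions A, B, C and D listed in the context hold, with data $\Lambda_0$, $\{H_{0,\lambda}\}$, $\mathfrak{H}_0$, $\mu_0$, $\{U_{t,\lambda}\}$, $\{H_\lambda\}$, $\mathfrak{H}$, $\mu$, $\{C_\lambda\}$. Then the measure $\mu$ is absolutely continuous with respect to the measure $\mu_0$ on $\Lambda_0$, and the Radon–Nikodym derivative of $\mu$ with respect to $\mu_0$ on $\Lambda_0$ is $$\frac{d\mu}{d\mu_0}(\lambda)=\frac{\dim(H_{0,\lambda})}{\operatorname{Trace}(C_\lambda^*C_\lambda)}.$$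
   Context: Elements of $A$ are viewed as continuous functions on the locally compact space $\Lambda$. Inner products are conjugate-linear in the first variable. Asymptotic containment: $\pi_0$ is asymptotically contained in $\pi$ if (i) there is a one-parameter group of unitary operators $U_t\colon H_0\to H_0$ ($t\in\mathbb{R}$) that commute with the operators in $\pi_0[A]$, and (ii) there is a bounded operator $W\colon H_0\to H$ such that for every $a\in A$ and $u,v\in H_0$, $$\lim_{t\to+\infty}\bigl[\langle u,\pi_0(a)v\rangle_{H_0}-\langle WU_tu,\pi(a)WU_tv\rangle_H\bigr]=0.$$ Assumption A. There are given: (i) an open subset $\Lambda_0\subseteq\Lambda$ and a locally trivial continuous field of finite-dimensional Hilbert spaces $\{H_{0,\lambda}\}_{\lambda\in\Lambda_0}$ (a Hermitian vector bundle over $\Lambda_0$); (ii) a dense subspace $\mathfrak{H}_0\subseteq H_0$ and a linear map $h\mapsto\{h_{0,\lambda}\}$ from $\mathfrak{H}_0$ into the continuous sections of $\{H_{0,\lambda}\}$ such that $H_{0,\lambda}=\{h_{0,\lambda}:h\in\mathfrak{H}_0\}$ for every $\lambda\in\Lambda_0$; (iii) a Borel measure $\mu_0$ on $\Lambda_0$ such that for all $h,g\in\mathfrak{H}_0$ the function $\lambda\mapsto\langle h_{0,\lambda},g_{0,\lambda}\rangle$ is $\mu_0$-integrable and, for every $a\in A$, $\langle h,\pi_0(a)g\rangle_{H_0}=\int_{\Lambda_0}\langle h_{0,\lambda},g_{0,\lambda}\rangle_{H_{0,\lambda}}\,a(\lambda)\,d\mu_0(\lambda)$. Assumption B. Each $U_t$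 maps $\mathfrak{H}_0$ into itself, and the continuous field $\{H_{0,\lambda}\}_{\lambda\in\Lambda_0}$ carries a continuous, unitary (fiberwise) action $\{U_{t,\lambda}\}$ of $\mathbb{R}$ such that $(U_th)_{0,\lambda}=U_{t,\lambda}h_{0,\lambda}$ for every $h\in\mathfrak{H}_0$, $t\in\mathbb{R}$ and $\lambda\in\Lambda_0$. Assumption C. There are given: (i) a locally trivial continuous field of one-dimensional Hilbert spaces $\{H_\lambda\}_{\lambda\in\Lambda}$ (a Hermitian line bundle over $\Lambda$); (ii) a dense subspace $\mathfrak{H}\subseteq H$ such that if $h\in\mathfrak{H}_0$ then $WU_th\in\mathfrak{H}$ for all sufficiently large $t$; (iii) a family of linear maps $\mathfrak{H}\to H_\lambda$, $h\mapsto h_\lambda$, such that $\{h_\lambda\}$ is a continuous section for each $h\in\mathfrak{H}$, and a Borel measure $\mu$ on $\Lambda$ such that for all $h,g\in\mathfrak{H}$ the function $\lambda\mapsto\langle h_\lambda,g_\lambda\rangle$ is $\mu$-integrable and, for every $a\in A$, $\langle h,\pi(a)g\rangle_H=\int_\Lambda\langle h_\lambda,g_\lambda\rangle_{H_\lambda}\,a(\lambda)\,d\mu(\lambda)$. Assumption D. There is given a continuous family of injective linear maps $C_\lambda\colon H_\lambda\to H_{0,\lambda}$ ($\lambda\in\Lambda_0$) such that for every $h\in\mathfrak{H}_0$, every continuous section $\{v_\lambda\}$ of $\{H_\lambda\}$ and every compact $K\subseteq\Lambda_0$, $$\lim_{t\to+\infty}\sup_{\lambda\in K}\bigl|\langle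 C_\lambda v_\lambda,(U_th)_{0,\lambda}\rangle_{H_{0,\lambda}}-\langle v_\lambda,(WU_th)_\lambda\rangle_{H_\lambda}\bigr|=0.$$ *)

theory Defs
  imports "HOL-Analysis.Analysis"
begin

section \<open>Complex vector spaces and Hilbert spaces\<close>

class complex_vector = real_vector +
  fixes scaleC :: "complex \<Rightarrow> 'a \<Rightarrow> 'a" (infixr "*\<^sub>C" 75)
  assumes scaleC_add_right: "c *\<^sub>C (x + y) = c *\<^sub>C x + c *\<^sub>C y"
    and scaleC_add_left: "(c + d) *\<^sub>C x = c *\<^sub>C x + d *\<^sub>C x"
    and scaleC_scaleC: "c *\<^sub>C d *\<^sub>C x = (c * d) *\<^sub>C x"
    and scaleC_one: "1 *\<^sub>C x = x"
    and scaleR_scaleC: "r *\<^sub>R x = complex_of_real r *\<^sub>C x"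

global_interpretation complex_vector: vector_space
  "scaleC :: complex \<Rightarrow> 'a \<Rightarrow> 'a::complex_vector"
  by unfold_locales (simp_all add: scaleC_add_right scaleC_add_left scaleC_scaleC scaleC_one)

text \<open>
  The inner product is conjugate-linear in the first variable.  Positivity is inherited from
  the class \<^class>\<open>real_inner\<close>, of which \<open>Re \<langle>x, y\<rangle>\<close> is the real inner product; hence the norm,
  the topology and completeness are those of the library.
\<close>

class complex_inner = complex_vector + real_inner +
  fixes cinner :: "'a \<Rightarrow> 'a \<Rightarrow> complex"
  assumes cinner_commute: "cinner x y = cnj (cinner y x)"
    and cinner_add_right: "cinner x (y + z) = cinner x y + cinner x z"
    and cinner_scaleC_right: "cinner x (c *\<^sub>C y) = c * cinner x y"
    and inner_Re_cinner: "inner x y = Re (cinner x y)"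

class complex_hilbert = complex_inner + complete_space

instantiation complex :: complex_hilbert
begin

definition scaleC_complex :: "complex \<Rightarrow> complex \<Rightarrow> complex"
  where "scaleC_complex c x = c * x"

definition cinner_complex :: "complex \<Rightarrow> complex \<Rightarrow> complex"
  where "cinner_complex x y = cnj x * y"

instance
  by standard
    (simp_all add: scaleC_complex_def cinner_complex_def algebra_simps scaleR_conv_of_real
      inner_complex_def)

end

definition clinear_on :: "'a::complex_vector set \<Rightarrow> ('a \<Rightarrow> 'b::complex_vector) \<Rightarrow> bool"
  where "clinear_on S f \<longleftrightarrow>
    (\<forall>x\<in>S. \<forall>y\<in>S. f (x + y) = f x + f y) \<and> (\<forall>c. \<forall>x\<in>S. f (c *\<^sub>C x) = c *\<^sub>C f x)"

definition bounded_clinear :: "('a::complex_inner \<Rightarrow> 'b::complex_inner) \<Rightarrow> bool"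
  where "bounded_clinear f \<longleftrightarrow> clinear_on UNIV f \<and> bounded_linear f"

definition unitary_between ::
  "'a::complex_inner set \<Rightarrow> 'b::complex_inner set \<Rightarrow> ('a \<Rightarrow> 'b) \<Rightarrow> bool"
  where "unitary_between S T f \<longleftrightarrow>
    clinear_on S f \<and> f ` S = T \<and> (\<forall>x\<in>S. \<forall>y\<in>S. cinner (f x) (f y) = cinner x y)"

definition finite_dimensional :: "'a::complex_vector set \<Rightarrow> bool"
  where "finite_dimensional S \<longleftrightarrow> (\<exists>B. finite B \<and> complex_vector.span B = S)"

definition dense_subspace :: "'a::complex_inner set \<Rightarrow> bool"
  where "dense_subspace D \<longleftrightarrow> complex_vector.subspace D \<and> closure D = UNIV"

text \<open>The adjoint of a linear map defined on a subspace \<open>S\<close>; its values lie in \<open>S\<close>.\<close>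

definition adjoint_on ::
  "'a::complex_inner set \<Rightarrow> ('a \<Rightarrow> 'b::complex_inner) \<Rightarrow> 'b \<Rightarrow> 'a"
  where "adjoint_on S f y = (THE x. x \<in> S \<and> (\<forall>z\<in>S. cinner z x = cinner (f z) y))"

text \<open>The trace of an operator \<open>T\<close> on a finite-dimensional subspace \<open>S\<close>: the sum of the
  diagonal entries of its matrix in a basis of \<open>S\<close>.\<close>

definition trace_on :: "'a::complex_vector set \<Rightarrow> ('a \<Rightarrow> 'a) \<Rightarrow> complex"
  where "trace_on S T =
    (let B = (SOME B. \<not> complex_vector.dependent B \<and> complex_vector.span B = S)
     in \<Sum>b\<in>B. complex_vector.representation B (T b) b)"

section \<open>Continuous fields of Hilbert spaces\<close>

text \<open>
  A family \<open>{F l}\<close> of Hilbert spaces over \<open>X\<close> is given by subspaces of one complex inner product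
  space.  This is no restriction: every family of Hilbert spaces sits in its algebraic
  orthogonal direct sum.  The position of the fibres in the ambient space carries no meaning;
  how they vary with \<open>l\<close> is encoded only in the space \<open>\<Gamma>\<close> of continuous sections.  Sections are
  total functions whose values outside the base are irrelevant.

  \<open>sections_over F \<Gamma> V\<close> are the sections over \<open>V\<close> that are locally uniform limits of members
  of \<open>\<Gamma>\<close>, that is, the continuous sections over \<open>V\<close> of the field generated by \<open>\<Gamma>\<close>.
\<close>

definition sections_over ::
  "('x::topological_space \<Rightarrow> 'f::complex_inner set) \<Rightarrow> ('x \<Rightarrow> 'f) set \<Rightarrow> 'x set \<Rightarrow> ('x \<Rightarrow> 'f) set"
  where "sections_over F \<Gamma> V = {x. (\<forall>l\<in>V. x l \<in> F l) \<and>
    (\<forall>l\<in>V. \<forall>e>0. \<exists>y\<in>\<Gamma>. \<exists>N. openin (top_of_set V) N \<and> l \<in> N \<and> (\<forall>z\<in>N. norm (x z - y z) \<le> e))}"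

text \<open>Continuous fields in the sense of Dixmier and Douady.\<close>

definition continuous_field ::
  "'x::topological_space set \<Rightarrow> ('x \<Rightarrow> 'f::complex_inner set) \<Rightarrow> ('x \<Rightarrow> 'f) set \<Rightarrow> bool"
  where "continuous_field X F \<Gamma> \<longleftrightarrow>
    (\<forall>l\<in>X. complex_vector.subspace (F l) \<and> complete (F l)) \<and>
    (\<forall>x\<in>\<Gamma>. \<forall>l\<in>X. x l \<in> F l) \<and>
    (\<lambda>l. 0) \<in> \<Gamma> \<and>
    (\<forall>x\<in>\<Gamma>. \<forall>y\<in>\<Gamma>. (\<lambda>l. x l + y l) \<in> \<Gamma>) \<and>
    (\<forall>c. \<forall>x\<in>\<Gamma>. (\<lambda>l. c *\<^sub>C x l) \<in> \<Gamma>) \<and>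
    (\<forall>l\<in>X. F l \<subseteq> closure ((\<lambda>x. x l) ` \<Gamma>)) \<and>
    (\<forall>x\<in>\<Gamma>. continuous_on X (\<lambda>l. norm (x l))) \<and>
    sections_over F \<Gamma> X \<subseteq> \<Gamma>"

text \<open>Locally, the field is unitarily isomorphic to the constant field whose fibre is the
  Hilbert space \<open>F l\<close>.\<close>

definition locally_trivial ::
  "'x::topological_space set \<Rightarrow> ('x \<Rightarrow> 'f::complex_inner set) \<Rightarrow> ('x \<Rightarrow> 'f) set \<Rightarrow> bool"
  where "locally_trivial X F \<Gamma> \<longleftrightarrow>
    (\<forall>l\<in>X. \<exists>V \<phi>. openin (top_of_set X) V \<and> l \<in> V \<and>
      (\<forall>z\<in>V. unitary_between (F z) (F l) (\<phi> z)) \<and>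
      (\<forall>x. (\<forall>z\<in>V. x z \<in> F z) \<longrightarrow>
        (x \<in> sections_over F \<Gamma> V \<longleftrightarrow> continuous_on V (\<lambda>z. \<phi> z (x z)))))"

definition hermitian_bundle ::
  "'x::topological_space set \<Rightarrow> ('x \<Rightarrow> 'f::complex_inner set) \<Rightarrow> ('x \<Rightarrow> 'f) set \<Rightarrow> bool"
  where "hermitian_bundle X F \<Gamma> \<longleftrightarrow>
    continuous_field X F \<Gamma> \<and> locally_trivial X F \<Gamma> \<and> (\<forall>l\<in>X. finite_dimensional (F l))"

text \<open>Continuity in \<open>(t, l)\<close> jointly: each continuous section \<open>x\<close> is mapped to a continuous section
  \<open>(t, l) \<mapsto> U t l (x l)\<close> of the pullback of the field to \<open>\<real> \<times> X\<close>.\<close>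

definition continuous_unitary_action ::
  "'x::topological_space set \<Rightarrow> ('x \<Rightarrow> 'f::complex_inner set) \<Rightarrow> ('x \<Rightarrow> 'f) set \<Rightarrow>
   (real \<Rightarrow> 'x \<Rightarrow> 'f \<Rightarrow> 'f) \<Rightarrow> bool"
  where "continuous_unitary_action X F \<Gamma> U \<longleftrightarrow>
    (\<forall>t. \<forall>l\<in>X. unitary_between (F l) (F l) (U t l)) \<and>
    (\<forall>l\<in>X. \<forall>v\<in>F l. U 0 l v = v) \<and>
    (\<forall>s t. \<forall>l\<in>X. \<forall>v\<in>F l. U (s + t) l v = U s l (U t l v)) \<and>
    (\<forall>x\<in>\<Gamma>. (\<lambda>(t, l). U t l (x l)) \<in>
      sections_over (\<lambda>(t, l). F l) ((\<lambda>y (t, l). y l) ` \<Gamma>) (UNIV \<times> X))"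

section \<open>Representations and asymptotic containment\<close>

definition C0 :: "('l::topological_space \<Rightarrow> complex) set"
  where "C0 = {a. continuous_on UNIV a \<and>
    (\<forall>e>0. \<exists>K. compact K \<and> (\<forall>l. l \<notin> K \<longrightarrow> norm (a l) < e))}"

text \<open>Separability of the algebra in the supremum norm.\<close>

definition separable_C0 :: "'l::topological_space itself \<Rightarrow> bool"
  where "separable_C0 _ \<longleftrightarrow> (\<exists>D \<subseteq> (C0 :: ('l \<Rightarrow> complex) set). countable D \<and>
    (\<forall>a\<in>C0. \<forall>e>0. \<exists>d\<in>D. \<forall>l. norm (a l - d l) \<le> e))"

definition representation_C0 ::
  "(('l::topological_space \<Rightarrow> complex) \<Rightarrow> 'h::complex_hilbert \<Rightarrow> 'h) \<Rightarrow> bool"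
  where "representation_C0 \<pi> \<longleftrightarrow>
    (\<forall>a\<in>C0. bounded_clinear (\<pi> a)) \<and>
    (\<forall>a\<in>C0. \<forall>b\<in>C0. \<forall>u. \<pi> (\<lambda>l. a l + b l) u = \<pi> a u + \<pi> b u) \<and>
    (\<forall>c. \<forall>a\<in>C0. \<forall>u. \<pi> (\<lambda>l. c * a l) u = c *\<^sub>C \<pi> a u) \<and>
    (\<forall>a\<in>C0. \<forall>b\<in>C0. \<forall>u. \<pi> (\<lambda>l. a l * b l) u = \<pi> a (\<pi> b u)) \<and>
    (\<forall>a\<in>C0. \<forall>u v. cinner (\<pi> a u) v = cinner u (\<pi> (\<lambda>l. cnj (a l)) v))"

definition nondegenerate ::
  "(('l::topological_space \<Rightarrow> complex) \<Rightarrow> 'h::complex_hilbert \<Rightarrow> 'h) \<Rightarrow> bool"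
  where "nondegenerate \<pi> \<longleftrightarrow> closure (complex_vector.span {\<pi> a u | a u. a \<in> C0}) = UNIV"

definition unitary_group :: "(real \<Rightarrow> 'h::complex_hilbert \<Rightarrow> 'h) \<Rightarrow> bool"
  where "unitary_group U \<longleftrightarrow>
    (\<forall>t. unitary_between UNIV UNIV (U t)) \<and> U 0 = id \<and> (\<forall>s t. U (s + t) = U s \<circ> U t)"

definition asymptotically_contained_via ::
  "(('l::topological_space \<Rightarrow> complex) \<Rightarrow> 'h0::complex_hilbert \<Rightarrow> 'h0) \<Rightarrow>
   (('l \<Rightarrow> complex) \<Rightarrow> 'h::complex_hilbert \<Rightarrow> 'h) \<Rightarrow>
   (real \<Rightarrow> 'h0 \<Rightarrow> 'h0) \<Rightarrow> ('h0 \<Rightarrow> 'h) \<Rightarrow> bool"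
  where "asymptotically_contained_via \<pi>0 \<pi> U W \<longleftrightarrow>
    unitary_group U \<and>
    (\<forall>t. \<forall>a\<in>C0. U t \<circ> \<pi>0 a = \<pi>0 a \<circ> U t) \<and>
    bounded_clinear W \<and>
    (\<forall>a\<in>C0. \<forall>u v.
      ((\<lambda>t. cinner u (\<pi>0 a v) - cinner (W (U t u)) (\<pi> a (W (U t v)))) \<longlongrightarrow> 0) at_top)"

section \<open>The assumptions\<close>

text \<open>
  \<open>s h l\<close> is the value \<open>h\<^sub>l\<close> at \<open>l\<close> of the section attached to \<open>h \<in> D\<close>.  The measure \<open>\<mu>\<close> lives on the
  Borel sets of the subspace \<open>X\<close>.
\<close>

definition spectral_decomposition ::
  "(('l::topological_space \<Rightarrow> complex) \<Rightarrow> 'h::complex_hilbert \<Rightarrow> 'h) \<Rightarrow> 'l set \<Rightarrow>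
   ('l \<Rightarrow> 'f::complex_inner set) \<Rightarrow> ('l \<Rightarrow> 'f) set \<Rightarrow> 'h set \<Rightarrow> ('h \<Rightarrow> 'l \<Rightarrow> 'f) \<Rightarrow> 'l measure \<Rightarrow> bool"
  where "spectral_decomposition \<pi> X F \<Gamma> D s \<mu> \<longleftrightarrow>
    dense_subspace D \<and>
    (\<forall>h\<in>D. s h \<in> \<Gamma>) \<and>
    (\<forall>l\<in>X. clinear_on D (\<lambda>h. s h l)) \<and>
    sets \<mu> = sets (restrict_space borel X) \<and>
    (\<forall>h\<in>D. \<forall>g\<in>D. integrable \<mu> (\<lambda>l. cinner (s h l) (s g l)) \<and>
      (\<forall>a\<in>C0. cinner h (\<pi> a g) = (LINT l|\<mu>. cinner (s h l) (s g l) * a l)))"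

definition assumption_A ::
  "(('l::topological_space \<Rightarrow> complex) \<Rightarrow> 'h0::complex_hilbert \<Rightarrow> 'h0) \<Rightarrow> 'l set \<Rightarrow>
   ('l \<Rightarrow> 'f::complex_inner set) \<Rightarrow> ('l \<Rightarrow> 'f) set \<Rightarrow> 'h0 set \<Rightarrow> ('h0 \<Rightarrow> 'l \<Rightarrow> 'f) \<Rightarrow> 'l measure \<Rightarrow> bool"
  where "assumption_A \<pi>0 \<Lambda>0 F0 \<Gamma>0 D0 s0 \<mu>0 \<longleftrightarrow>
    open \<Lambda>0 \<and> hermitian_bundle \<Lambda>0 F0 \<Gamma>0 \<and>
    spectral_decomposition \<pi>0 \<Lambda>0 F0 \<Gamma>0 D0 s0 \<mu>0 \<and>
    (\<forall>l\<in>\<Lambda>0. F0 l = (\<lambda>h. s0 h l) ` D0)"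

definition assumption_B ::
  "'l::topological_space set \<Rightarrow> ('l \<Rightarrow> 'f::complex_inner set) \<Rightarrow> ('l \<Rightarrow> 'f) set \<Rightarrow>
   'h0::complex_hilbert set \<Rightarrow> ('h0 \<Rightarrow> 'l \<Rightarrow> 'f) \<Rightarrow> (real \<Rightarrow> 'h0 \<Rightarrow> 'h0) \<Rightarrow>
   (real \<Rightarrow> 'l \<Rightarrow> 'f \<Rightarrow> 'f) \<Rightarrow> bool"
  where "assumption_B \<Lambda>0 F0 \<Gamma>0 D0 s0 U Ufib \<longleftrightarrow>
    (\<forall>t. U t ` D0 \<subseteq> D0) \<and>
    continuous_unitary_action \<Lambda>0 F0 \<Gamma>0 Ufib \<and>
    (\<forall>h\<in>D0. \<forall>t. \<forall>l\<in>\<Lambda>0. s0 (U t h) l = Ufib t l (s0 h l))"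

definition assumption_C ::
  "(('l::topological_space \<Rightarrow> complex) \<Rightarrow> 'h::complex_hilbert \<Rightarrow> 'h) \<Rightarrow>
   ('l \<Rightarrow> 'g::complex_inner set) \<Rightarrow> ('l \<Rightarrow> 'g) set \<Rightarrow> 'h set \<Rightarrow> ('h \<Rightarrow> 'l \<Rightarrow> 'g) \<Rightarrow> 'l measure \<Rightarrow>
   'h0::complex_hilbert set \<Rightarrow> (real \<Rightarrow> 'h0 \<Rightarrow> 'h0) \<Rightarrow> ('h0 \<Rightarrow> 'h) \<Rightarrow> bool"
  where "assumption_C \<pi> F \<Gamma> D s \<mu> D0 U W \<longleftrightarrow>
    hermitian_bundle UNIV F \<Gamma> \<and> (\<forall>l. complex_vector.dim (F l) = 1) \<and>
    spectral_decomposition \<pi> UNIV F \<Gamma> D s \<mu> \<and>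
    (\<forall>h\<in>D0. \<forall>\<^sub>F t in at_top. W (U t h) \<in> D)"

text \<open>Continuity of the family \<open>C\<close> means that it maps continuous sections over \<open>\<Lambda>0\<close> to continuous
  sections.  The supremum is taken in \<^typ>\<open>ennreal\<close>, so that it is \<open>0\<close> when \<open>K\<close> is empty.\<close>

definition assumption_D ::
  "'l::topological_space set \<Rightarrow> ('l \<Rightarrow> 'f::complex_inner set) \<Rightarrow> ('l \<Rightarrow> 'f) set \<Rightarrow>
   'h0::complex_hilbert set \<Rightarrow> ('h0 \<Rightarrow> 'l \<Rightarrow> 'f) \<Rightarrow>
   ('l \<Rightarrow> 'g::complex_inner set) \<Rightarrow> ('l \<Rightarrow> 'g) set \<Rightarrow> ('h::complex_hilbert \<Rightarrow> 'l \<Rightarrow> 'g) \<Rightarrow>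
   (real \<Rightarrow> 'h0 \<Rightarrow> 'h0) \<Rightarrow> ('h0 \<Rightarrow> 'h) \<Rightarrow> ('l \<Rightarrow> 'g \<Rightarrow> 'f) \<Rightarrow> bool"
  where "assumption_D \<Lambda>0 F0 \<Gamma>0 D0 s0 F \<Gamma> s U W C \<longleftrightarrow>
    (\<forall>l\<in>\<Lambda>0. clinear_on (F l) (C l) \<and> C l ` F l \<subseteq> F0 l \<and> inj_on (C l) (F l)) \<and>
    (\<forall>v \<in> sections_over F \<Gamma> \<Lambda>0. (\<lambda>l. C l (v l)) \<in> \<Gamma>0) \<and>
    (\<forall>h\<in>D0. \<forall>v\<in>\<Gamma>. \<forall>K. compact K \<and> K \<subseteq> \<Lambda>0 \<longrightarrow>
      ((\<lambda>t. SUP l\<in>K. ennreal (norm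
          (cinner (C l (v l)) (s0 (U t h) l) - cinner (v l) (s (W (U t h)) l)))) \<longlongrightarrow> 0) at_top)"

definition dim_over_trace ::
  "('l \<Rightarrow> 'f::complex_inner set) \<Rightarrow> ('l \<Rightarrow> 'g::complex_inner set) \<Rightarrow> ('l \<Rightarrow> 'g \<Rightarrow> 'f) \<Rightarrow> 'l \<Rightarrow> real"
  where "dim_over_trace F0 F C l =
    real (complex_vector.dim (F0 l)) / Re (trace_on (F l) (adjoint_on (F l) (C l) \<circ> C l))"

end

theory Submission
  imports Defs
begin

text \<open>
  Near a point of \<open>\<Lambda>0\<close> pick a continuous section \<open>v\<close> of the line bundle without zeros.  Since the
  fibres \<open>F l\<close> are one-dimensional, \<open>|v|\<^sup>2 \<langle>x, y\<rangle> = \<langle>x, v\<rangle> \<langle>v, y\<rangle>\<close>, so for \<open>a\<close> continuous with compact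
  support near the point,
  \<open>\<langle>W U\<^sub>t h, \<pi>(|v|\<^sup>2 a) W U\<^sub>t g\<rangle> = \<integral> cnj \<langle>v, (W U\<^sub>t h)\<rangle> \<langle>v, (W U\<^sub>t g)\<rangle> a d\<mu>\<close>.
  As \<open>t\<close> grows, the left side tends to \<open>\<langle>h, \<pi>0(|v|\<^sup>2 a) g\<rangle> = \<integral> |v|\<^sup>2 \<langle>h, g\<rangle> a d\<mu>0\<close>, while on the right
  \<open>\<langle>v, (W U\<^sub>t h)\<rangle>\<close> may be replaced, uniformly on compact sets, by \<open>\<langle>C v, U\<^sub>t h\<rangle>\<close>.  Hence
  (\<open>generator_limit\<close>)
  \<open>\<integral> |v|\<^sup>2 \<langle>h, g\<rangle> a d\<mu>0 = lim\<^sub>t \<integral> cnj \<langle>C v, U\<^sub>t h\<rangle> \<langle>C v, U\<^sub>t g\<rangle> a d\<mu>\<close>.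

  Both sides are sesquilinear over continuous functions, because such a function can be absorbed
  into \<open>a\<close>.  So the identity extends (\<open>module_limit\<close>) from the sections \<open>s0 h\<close> to the module that
  they generate over the continuous functions on a small open set, and in this module Gram-Schmidt
  produces a local orthonormal frame \<open>e\<^sub>1, \<dots>, e\<^sub>n\<close> (\<open>exists_local_orthonormal_frame\<close>).  Put
  \<open>h = g = e\<^sub>i\<close> and sum over \<open>i\<close>.  The fibre maps \<open>U\<^sub>t\<close> are unitary, so by Parseval
  \<open>\<Sum>\<^sub>i |\<langle>C v, U\<^sub>t e\<^sub>i\<rangle>|\<^sup>2 = |C v|\<^sup>2\<close> for every \<open>t\<close>: the limit disappears, and
  \<open>n \<integral> |v|\<^sup>2 a d\<mu>0 = \<integral> |C v|\<^sup>2 a d\<mu>\<close>.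
  Since \<open>Trace (C\<^sup>* C) = |C v|\<^sup>2 / |v|\<^sup>2\<close> on a line, replacing \<open>a\<close> by \<open>a / |C v|\<^sup>2\<close> yields
  \<open>\<integral> (n / Trace (C\<^sup>* C)) a d\<mu>0 = \<integral> a d\<mu>\<close> for all such \<open>a\<close> (\<open>local_density\<close>).

  It remains to pass from test functions to Borel sets (\<open>density_eqI_local\<close>).  Separability of
  \<open>C0\<close> makes the spectrum second countable, so that open sets are increasing limits of test functions
  and countably many of the small open sets suffice.  Finiteness of both measures on these sets
  comes from the integrability of \<open>|h|\<^sup>2\<close> for a section \<open>h\<close> that does not vanish at the point; for \<open>\<mu>\<close>,
  such a section exists because otherwise \<open>\<langle>C v, U\<^sub>t e\<^sub>i\<rangle>\<close> would tend to \<open>0\<close> for all \<open>i\<close>, against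
  Parseval.
\<close>

section \<open>Complex inner products and orthonormal families\<close>

lemma cinner_add_left: "cinner (x + y) z = cinner x z + cinner y z"
  by (metis cinner_add_right cinner_commute complex_cnj_add)

lemma cinner_scaleC_left: "cinner (c *\<^sub>C x) y = cnj c * cinner x y"
  by (metis cinner_commute cinner_scaleC_right complex_cnj_mult)

lemma cinner_zero_right [simp]: "cinner x 0 = 0"
  using cinner_add_right[of x 0 0] by simp

lemma cinner_sum_right: "cinner x (\<Sum>i\<in>I. f i) = (\<Sum>i\<in>I. cinner x (f i))"
  by (induction I rule: infinite_finite_induct) (auto simp: cinner_add_right)

lemma cinner_self: "cinner x x = complex_of_real ((norm x)\<^sup>2)"
proof -
  have "Im (cinner x x) = 0"
    using arg_cong[OF cinner_commute[of x x], of Im] by simp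
  moreover have "Re (cinner x x) = (norm x)\<^sup>2"
    by (simp add: power2_norm_eq_inner inner_Re_cinner)
  ultimately show ?thesis by (simp add: complex_eq_iff)
qed

lemma norm_scaleC: "norm (c *\<^sub>C x) = norm c * norm (x :: 'a::complex_inner)"
proof -
  have "complex_of_real ((norm (c *\<^sub>C x))\<^sup>2) = cnj c * c * complex_of_real ((norm x)\<^sup>2)"
    by (metis ab_semigroup_mult_class.mult_ac(1) cinner_scaleC_left cinner_scaleC_right cinner_self)
  also have "cnj c * c = complex_of_real ((norm c)\<^sup>2)"
    by (metis complex_norm_square mult.commute)
  finally have "complex_of_real ((norm (c *\<^sub>C x))\<^sup>2) = complex_of_real ((norm c * norm x)\<^sup>2)"
    by (simp add: power_mult_distrib)
  then have "(norm (c *\<^sub>C x))\<^sup>2 = (norm c * norm x)\<^sup>2"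
    by (simp only: of_real_eq_iff)
  then show ?thesis by (simp add: power2_eq_iff_nonneg)
qed

lemma norm_cinner_le: "norm (cinner x y) \<le> norm x * norm y"
proof -
  \<comment> \<open>Rotating \<open>y\<close> by this phase makes the inner product real, so that the real Cauchy-Schwarz applies.\<close>
  define c where "c = cnj (sgn (cinner x y))"
  have "cinner x y * c = complex_of_real (norm (cinner x y))"
    by (cases "cinner x y = 0")
      (auto simp: c_def sgn_eq complex_norm_square[symmetric] power2_eq_square field_simps)
  then have "norm (cinner x y) = Re (cinner x (c *\<^sub>C y))"
    by (simp add: cinner_scaleC_right mult.commute)
  also have "\<dots> \<le> norm x * norm (c *\<^sub>C y)"
    by (metis inner_Re_cinner norm_cauchy_schwarz)
  also have "\<dots> \<le> norm x * norm y"
    by (intro mult_left_mono) (auto simp: norm_scaleC c_def norm_sgn)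
  finally show ?thesis .
qed

text \<open>
  Polarization in a form suited to continuity proofs: the complex inner product is controlled by
  the real one, and hence by norms of sums.
\<close>

lemma cinner_eq_inner: "cinner x y = Complex (inner x y) (inner x ((-\<i>) *\<^sub>C y))"
  by (simp add: complex_eq_iff inner_Re_cinner cinner_scaleC_right del: complex_vector.scale_minus_left)

lemma unitary_between_simps:
  assumes "unitary_between S T f" "x \<in> S"
  shows "f x \<in> T" "y \<in> S \<Longrightarrow> f (x + y) = f x + f y" "f (c *\<^sub>C x) = c *\<^sub>C f x"
    "y \<in> S \<Longrightarrow> cinner (f x) (f y) = cinner x y"
    "norm (f x) = norm x"
proof -
  show *: "y \<in> S \<Longrightarrow> cinner (f x) (f y) = cinner x y" for y
    using assms by (auto simp: unitary_between_def)
  have "complex_of_real ((norm (f x))\<^sup>2) = complex_of_real ((norm x)\<^sup>2)"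
    using *[OF assms(2)] by (simp add: cinner_self)
  then have "(norm (f x))\<^sup>2 = (norm x)\<^sup>2" by (simp only: of_real_eq_iff)
  then show "norm (f x) = norm x" by simp
qed (use assms in \<open>auto simp: unitary_between_def clinear_on_def\<close>)

definition orthonormal_family :: "nat \<Rightarrow> (nat \<Rightarrow> 'a::complex_inner) \<Rightarrow> bool"
  where "orthonormal_family k e \<longleftrightarrow> (\<forall>i<k. \<forall>j<k. cinner (e i) (e j) = (if i = j then 1 else 0))"

lemma orthonormal_coefficient:
  assumes "orthonormal_family k e" "i < k"
  shows "cinner (e i) (\<Sum>j<k. c j *\<^sub>C e j) = c i"
proof -
  have "cinner (e i) (\<Sum>j<k. c j *\<^sub>C e j) = (\<Sum>j<k. c j * cinner (e i) (e j))"
    by (simp add: cinner_sum_right cinner_scaleC_right)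
  also have "\<dots> = (\<Sum>j<k. if j = i then c i else 0)"
    using assms by (intro sum.cong) (auto simp: orthonormal_family_def)
  finally show ?thesis using assms by simp
qed

lemma orthonormal_independent:
  assumes "orthonormal_family k e"
  shows "complex_vector.independent (e ` {..<k})" "inj_on e {..<k}"
proof -
  show inj: "inj_on e {..<k}"
    using assms unfolding orthonormal_family_def inj_on_def
    by (metis lessThan_iff one_neq_zero)
  show "complex_vector.independent (e ` {..<k})"
  proof (rule complex_vector.independent_if_scalars_zero)
    fix u v assume 0: "(\<Sum>v\<in>e ` {..<k}. u v *\<^sub>C v) = 0" and "v \<in> e ` {..<k}"
    then obtain i where i: "i < k" "v = e i" by auto
    have "(\<Sum>j<k. u (e j) *\<^sub>C e j) = 0"
      using 0 by (simp add: sum.reindex[OF inj] o_def)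
    then show "u v = 0"
      using orthonormal_coefficient[OF assms i(1), of "\<lambda>j. u (e j)"] i by simp
  qed simp
qed

text \<open>
  An orthonormal family with as many members as the dimension must span: a vector outside its span
  would give one independent vector too many.
\<close>

lemma orthonormal_basis_expansion:
  assumes e: "orthonormal_family (complex_vector.dim V) e"
    and mem: "\<And>i. i < complex_vector.dim V \<Longrightarrow> e i \<in> V"
    and V: "complex_vector.subspace V" "finite_dimensional V" and w: "w \<in> V"
  shows "w = (\<Sum>i<complex_vector.dim V. cinner (e i) w *\<^sub>C e i)"
proof -
  define n where "n = complex_vector.dim V"
  have e: "orthonormal_family n e" and mem: "e ` {..<n} \<subseteq> V"
    using e mem by (auto simp: n_def)
  have "w \<in> complex_vector.span (e ` {..<n})"
  proof (rule ccontr)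
    assume nin: "w \<notin> complex_vector.span (e ` {..<n})"
    let ?B = "insert w (e ` {..<n})"
    have ind: "complex_vector.independent ?B"
      by (intro complex_vector.independent_insertI nin orthonormal_independent[OF e])
    obtain S where S: "finite S" "complex_vector.span S = V"
      using V(2) by (auto simp: finite_dimensional_def)
    obtain B where B: "B \<subseteq> V" "complex_vector.independent B" "V \<subseteq> complex_vector.span B" "card B = n"
      using complex_vector.basis_exists n_def by metis
    have "finite B"
      using complex_vector.independent_span_bound[OF S(1) B(2)] B(1) S(2) by auto
    moreover have "?B \<subseteq> complex_vector.span B"
      using B(3) mem w by blast
    ultimately have "card ?B \<le> card B"
      using complex_vector.independent_span_bound[OF _ ind] by blast
    moreover have "w \<notin> e ` {..<n}"
      using nin complex_vector.span_base[of w "e ` {..<n}"] by metis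
    then have "card ?B = Suc n"
      by (simp add: card_image[OF orthonormal_independent(2)[OF e]])
    ultimately show False using B by simp
  qed
  then show ?thesis
    unfolding n_def[symmetric]
  proof (induction rule: complex_vector.span_induct_alt)
    case (step c x y)
    then obtain j where j: "j < n" "x = e j" by auto
    have "(\<Sum>i<n. cinner (e i) x *\<^sub>C e i) = (\<Sum>i<n. if i = j then x else 0)"
      using e j by (intro sum.cong) (auto simp: orthonormal_family_def complex_vector.scale_one)
    then have x: "(\<Sum>i<n. cinner (e i) x *\<^sub>C e i) = x" using j by simp
    have "(\<Sum>i<n. cinner (e i) (c *\<^sub>C x + y) *\<^sub>C e i)
        = c *\<^sub>C (\<Sum>i<n. cinner (e i) x *\<^sub>C e i) + (\<Sum>i<n. cinner (e i) y *\<^sub>C e i)"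
      by (simp add: cinner_add_right cinner_scaleC_right complex_vector.scale_sum_right
          sum.distrib scaleC_add_left scaleC_scaleC)
    also have "\<dots> = c *\<^sub>C x + y"
      unfolding x step.IH[symmetric] ..
    finally show ?case by (rule sym)
  qed simp
qed

lemma orthonormal_dim_eqI:
  assumes e: "orthonormal_family k e" and mem: "\<And>i. i < k \<Longrightarrow> e i \<in> V"
    and exp: "\<And>w. w \<in> V \<Longrightarrow> w = (\<Sum>i<k. cinner (e i) w *\<^sub>C e i)"
  shows "complex_vector.dim V = k"
proof (rule complex_vector.dim_unique)
  show "e ` {..<k} \<subseteq> V" using mem by auto
  show "V \<subseteq> complex_vector.span (e ` {..<k})"
  proof
    fix w assume "w \<in> V"
    have "(\<Sum>i<k. cinner (e i) w *\<^sub>C e i) \<in> complex_vector.span (e ` {..<k})"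
      by (intro complex_vector.span_sum complex_vector.span_scale complex_vector.span_base) auto
    then show "w \<in> complex_vector.span (e ` {..<k})" by (subst exp[OF \<open>w \<in> V\<close>])
  qed
  show "complex_vector.independent (e ` {..<k})" using orthonormal_independent[OF e] by simp
  show "card (e ` {..<k}) = k" using orthonormal_independent[OF e] by (simp add: card_image)
qed

lemma parseval:
  assumes "orthonormal_family (complex_vector.dim V) e"
    and "\<And>i. i < complex_vector.dim V \<Longrightarrow> e i \<in> V"
    and "complex_vector.subspace V" "finite_dimensional V" and "w \<in> V"
  shows "(\<Sum>i<complex_vector.dim V. cnj (cinner w (e i)) * cinner w (e i)) = complex_of_real ((norm w)\<^sup>2)"
proof -
  have "complex_of_real ((norm w)\<^sup>2) = cinner w (\<Sum>i<complex_vector.dim V. cinner (e i) w *\<^sub>C e i)"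
    using arg_cong[OF orthonormal_basis_expansion[OF assms], of "cinner w"] by (simp only: cinner_self)
  also have "\<dots> = (\<Sum>i<complex_vector.dim V. cnj (cinner w (e i)) * cinner w (e i))"
    by (simp add: cinner_sum_right cinner_scaleC_right cinner_commute[symmetric])
  finally show ?thesis by simp
qed

text \<open>
  The dimension of the fibres is constant wherever a local trivialization and an orthonormal
  frame coexist: \<open>f\<close> carries the frame to an orthonormal basis of \<open>V'\<close>, and expansions pull back
  along the isometry.
\<close>

lemma dim_unitary_between:
  assumes u: "unitary_between V V' f" and V: "complex_vector.subspace V" "finite_dimensional V"
    and e: "orthonormal_family (complex_vector.dim V') e"
      "\<And>i. i < complex_vector.dim V' \<Longrightarrow> e i \<in> V"
    and V': "complex_vector.subspace V'" "finite_dimensional V'"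
  shows "complex_vector.dim V = complex_vector.dim V'"
proof (rule orthonormal_dim_eqI[OF e])
  let ?n = "complex_vector.dim V'"
  fix w assume w: "w \<in> V"
  define w' where w'_def: "w' = (\<Sum>i<?n. cinner (e i) w *\<^sub>C e i)"
  have mem: "w' \<in> V"
    unfolding w'_def by (intro complex_vector.subspace_sum complex_vector.subspace_scale V e) auto
  have fw: "f w = (\<Sum>i<?n. cinner (f (e i)) (f w) *\<^sub>C f (e i))"
    using e unitary_between_simps[OF u] w
    by (intro orthonormal_basis_expansion) (auto simp: orthonormal_family_def V')
  have f0: "f 0 = 0"
    using unitary_between_simps(3)[OF u w, of 0] by simp
  have "f (\<Sum>i<m. c i *\<^sub>C e i) = (\<Sum>i<m. c i *\<^sub>C f (e i))" if "m \<le> ?n" for c m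
    using that
  proof (induction m)
    case (Suc m)
    have "(\<Sum>i<m. c i *\<^sub>C e i) \<in> V"
      using Suc.prems by (intro complex_vector.subspace_sum complex_vector.subspace_scale V e) auto
    then show ?case
      using Suc e unitary_between_simps[OF u] V
      by (auto simp: complex_vector.subspace_scale)
  qed (simp add: f0)
  then have fw': "f w' = f w"
    unfolding w'_def by (subst fw) (use e w unitary_between_simps(4)[OF u] in simp)
  have nrm: "norm (f (w - w')) = norm (w - w')"
    by (rule unitary_between_simps(5)[OF u complex_vector.subspace_diff[OF V(1) w mem]])
  have "f ((w - w') + w') = f (w - w') + f w'"
    by (rule unitary_between_simps(2)[OF u complex_vector.subspace_diff[OF V(1) w mem] mem])
  then have "f (w - w') = 0" using fw' by simp
  then show "w = (\<Sum>i<?n. cinner (e i) w *\<^sub>C e i)" using nrm unfolding w'_def[symmetric] by simp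
qed

section \<open>Lines, and the trace of \<open>f\<^sup>* f\<close> on a line\<close>

lemma one_dimensional_basis:
  assumes "complex_vector.dim S = 1" "complex_vector.subspace S"
    "complex_vector.independent B" "complex_vector.span B = S"
  obtains b where "B = {b}" "b \<noteq> 0"
proof -
  have "card B = 1"
    using assms(1) complex_vector.dim_span_eq_card_independent[OF assms(3), unfolded assms(4)] by argo
  then obtain b where "B = {b}" by (auto simp: card_1_singleton_iff)
  then show ?thesis using that assms(3) complex_vector.dependent_zero by blast
qed

lemma one_dimensional_span:
  assumes "complex_vector.dim S = 1" "complex_vector.subspace S"
  obtains b where "b \<noteq> 0" "b \<in> S" "complex_vector.span {b} = S"
proof -
  obtain B where B: "B \<subseteq> S" "complex_vector.independent B" "S \<subseteq> complex_vector.span B"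
    using complex_vector.basis_exists by metis
  then have "complex_vector.span B = S"
    using assms(2) by (meson complex_vector.span_subspace)
  then show ?thesis
    using one_dimensional_basis[OF assms B(2)] that B by (metis insert_subset)
qed

lemma one_dimensional_multiple:
  assumes "complex_vector.dim S = 1" "complex_vector.subspace S" "v \<in> S" "v \<noteq> 0" "x \<in> S"
  obtains c where "x = c *\<^sub>C v"
proof -
  obtain b where b: "b \<noteq> 0" "complex_vector.span {b} = S"
    using one_dimensional_span[OF assms(1,2)] by metis
  obtain c d where "v = c *\<^sub>C b" "x = d *\<^sub>C b"
    using assms(3,5) b(2)[symmetric] by (auto simp: complex_vector.span_singleton)
  moreover from this have "c \<noteq> 0" using assms(4) by auto
  ultimately have "x = (d / c) *\<^sub>C v" by (simp add: scaleC_scaleC)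
  then show ?thesis using that by blast
qed

text \<open>
  On a line, pairing with a single vector \<open>v\<close> recovers the inner product.  This is where the
  multiplicity one of \<open>\<pi>\<close> enters.
\<close>

lemma one_dimensional_cinner:
  assumes "complex_vector.dim S = 1" "complex_vector.subspace S" "v \<in> S" "v \<noteq> 0" "x \<in> S" "y \<in> S"
  shows "cinner x y * complex_of_real ((norm v)\<^sup>2) = cnj (cinner v x) * cinner v y"
proof -
  obtain c where "x = c *\<^sub>C v" using one_dimensional_multiple assms by metis
  moreover obtain d where "y = d *\<^sub>C v" using one_dimensional_multiple assms by metis
  ultimately show ?thesis
    by (simp add: cinner_scaleC_left cinner_scaleC_right cinner_self)
qed

text \<open>
  \<open>f\<^sup>* f\<close> is a scalar on a line; evaluating \<open>\<langle>v, f\<^sup>* f v\<rangle> = |f v|\<^sup>2\<close> identifies it.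
\<close>

lemma trace_adjoint_one_dimensional:
  fixes f :: "'a::complex_inner \<Rightarrow> 'b::complex_inner"
  assumes S: "complex_vector.dim S = 1" "complex_vector.subspace S" and f: "clinear_on S f"
    and v: "v \<in> S" "v \<noteq> 0"
  shows "trace_on S (adjoint_on S f \<circ> f) = complex_of_real ((norm (f v))\<^sup>2 / (norm v)\<^sup>2)"
proof -
  define B where "B = (SOME B. complex_vector.independent B \<and> complex_vector.span B = S)"
  have "\<exists>B. complex_vector.independent B \<and> complex_vector.span B = S"
    using complex_vector.basis_exists S(2) by (metis complex_vector.span_subspace)
  then have B: "complex_vector.independent B" "complex_vector.span B = S"
    unfolding B_def by (metis (mono_tags, lifting) someI_ex)+
  then obtain b where b: "B = {b}" "b \<noteq> 0"
    using one_dimensional_basis[OF S] by metis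
  have bS: "b \<in> S" using B b complex_vector.span_base by blast
  obtain c where c: "v = c *\<^sub>C b" using one_dimensional_multiple[OF S bS b(2) v(1)] .
  with v have c0: "c \<noteq> 0" by auto
  have lin: "f (d *\<^sub>C b) = d *\<^sub>C f b" for d using f bS by (auto simp: clinear_on_def)
  let ?r = "complex_of_real ((norm (f b))\<^sup>2 / (norm b)\<^sup>2)"
  have "adjoint_on S f (f b) = ?r *\<^sub>C b"
    unfolding adjoint_on_def
  proof (rule the_equality, safe)
    show "?r *\<^sub>C b \<in> S" using S bS by (simp add: complex_vector.subspace_scale)
    fix z assume "z \<in> S"
    then obtain d where "z = d *\<^sub>C b" using one_dimensional_multiple[OF S bS b(2)] by metis
    then show "cinner z (?r *\<^sub>C b) = cinner (f z) (f b)"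
      using b(2) by (simp add: lin cinner_scaleC_left cinner_scaleC_right cinner_self)
  next
    fix x assume x: "x \<in> S" "\<forall>z\<in>S. cinner z x = cinner (f z) (f b)"
    obtain d where d: "x = d *\<^sub>C b" using one_dimensional_multiple[OF S bS b(2) x(1)] .
    have "d * complex_of_real ((norm b)\<^sup>2) = complex_of_real ((norm (f b))\<^sup>2)"
      using x(2) bS by (auto simp: d cinner_scaleC_right cinner_self)
    then have "d = ?r" using b(2) by (simp add: field_simps)
    then show "x = ?r *\<^sub>C b" using d by simp
  qed
  then have "trace_on S (adjoint_on S f \<circ> f) = complex_vector.representation B (?r *\<^sub>C b) b"
    unfolding trace_on_def B_def[symmetric] Let_def by (simp add: b)
  also have "\<dots> = ?r"
    using complex_vector.representation_scale[OF B(1), of b ?r] complex_vector.representation_basis[OF B(1), of b] b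
    by (simp add: complex_vector.span_base)
  also have "\<dots> = complex_of_real ((norm (f v))\<^sup>2 / (norm v)\<^sup>2)"
    using c0 b(2) by (simp add: c lin norm_scaleC power_mult_distrib)
  finally show ?thesis .
qed

section \<open>Continuous functions of compact support\<close>

text \<open>
  Membership refers to total functions, so that extension by zero is built in.
\<close>

definition cc_on :: "'x::topological_space set \<Rightarrow> ('x \<Rightarrow> complex) set"
  where "cc_on K = {a. continuous_on UNIV a \<and> (\<forall>l. l \<notin> K \<longrightarrow> a l = 0)}"

text \<open>
  Outside \<open>K\<close> the product is zero whatever \<open>c\<close> is; continuity holds on each of
  the open sets \<open>N\<close> and \<open>- K\<close>, which cover the space.
\<close>

lemma cc_on_mult:
  fixes K :: "'x::t2_space set"
  assumes a: "a \<in> cc_on K" and K: "compact K" "K \<subseteq> N" "open N" and c: "continuous_on N c"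
  shows "(\<lambda>l. c l * a l) \<in> cc_on K"
proof -
  have "continuous_on N (\<lambda>l. c l * a l)"
    using a by (intro continuous_intros c) (auto simp: cc_on_def intro: continuous_on_subset)
  moreover have "continuous_on (- K) (\<lambda>l. c l * a l) \<longleftrightarrow> continuous_on (- K) (\<lambda>l. 0 :: complex)"
    using a by (intro continuous_on_cong) (auto simp: cc_on_def)
  moreover have "N \<union> - K = UNIV" using K by auto
  ultimately have "continuous_on UNIV (\<lambda>l. c l * a l)"
    using continuous_on_open_Un[of N "- K" "\<lambda>l. c l * a l"] K compact_imp_closed by auto
  then show ?thesis using a by (auto simp: cc_on_def)
qed

lemma cc_on_bounded:
  assumes "a \<in> cc_on K" "compact K"
  obtains B where "0 \<le> B" "\<And>l. norm (a l) \<le> B"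
proof -
  have "compact (a ` K)"
    using assms by (intro compact_continuous_image) (auto simp: cc_on_def intro: continuous_on_subset)
  then obtain B where B: "0 < B" "\<And>z. z \<in> a ` K \<Longrightarrow> norm z \<le> B"
    using compact_imp_bounded bounded_pos by metis
  have "norm (a l) \<le> B" for l
    using B assms by (cases "l \<in> K") (auto simp: cc_on_def)
  with B show ?thesis using that[of B] by auto
qed

lemma cc_on_C0: "compact K \<Longrightarrow> cc_on K \<subseteq> C0"
  by (auto simp: cc_on_def C0_def)

lemma cc_on_integrable:
  fixes K :: "'x::t2_space set"
  assumes "a \<in> cc_on K" "compact K" "K \<subseteq> X" "sets M = sets (restrict_space borel X)" "emeasure M K < \<infinity>"
  shows "integrable M a"
proof -
  have [measurable]: "a \<in> borel_measurable M"
  proof -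
    have "a \<in> borel_measurable borel"
      using assms(1) by (auto simp: cc_on_def intro: borel_measurable_continuous_onI)
    then have "a \<in> borel_measurable (restrict_space borel X)"
      by (rule measurable_restrict_space1)
    then show ?thesis using measurable_cong_sets[OF assms(4)] by blast
  qed
  obtain B where "\<And>l. norm (a l) \<le> B" using cc_on_bounded assms by metis
  moreover have "K = X \<inter> K" using assms by auto
  then have "K \<in> sets M"
    unfolding assms(4) sets_restrict_space using assms(2)
    by (metis (no_types, lifting) borel_compact rev_image_eqI)
  ultimately show ?thesis
    using assms by (intro integrableI_bounded_set[of K M a B]) (auto simp: cc_on_def)
qed

lemma Hausdorff_euclidean_t2: "Hausdorff_space (euclidean :: 'l::t2_space topology)"
  unfolding Hausdorff_space_def disjnt_def open_openin[symmetric] by (metis hausdorff)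

lemma exists_bump_function:
  fixes l :: "'l::t2_space"
  assumes lc: "locally_compact_space (euclidean :: 'l topology)" and S: "open S" "l \<in> S"
  obtains f :: "'l \<Rightarrow> real" and K where "continuous_on UNIV f" "\<And>z. 0 \<le> f z" "\<And>z. f z \<le> 1" "f l = 1"
    "compact K" "K \<subseteq> S" "\<And>z. z \<notin> K \<Longrightarrow> f z = 0"
proof -
  have "neighbourhood_base_of compact (euclidean :: 'l topology)"
    using locally_compact_space_neighbourhood_base[of "euclidean :: 'l topology"] lc
    by (simp add: compactin_euclidean_iff[abs_def] Hausdorff_euclidean_t2)
  then obtain V K where V: "open V" "compact K" "l \<in> V" "V \<subseteq> K" "K \<subseteq> S"
    using S unfolding neighbourhood_base_of by (metis open_openin)
  have "completely_regular_space (euclidean :: 'l topology)"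
    using locally_compact_regular_imp_completely_regular_space lc Hausdorff_euclidean_t2 by blast
  moreover have "closedin euclidean (- V)" "l \<in> topspace euclidean - (- V)"
    using V by (auto simp: closed_Compl)
  ultimately obtain f :: "'l \<Rightarrow> real" where
    f: "continuous_map euclidean (top_of_set {0..1}) f" "f l = 0" "f ` (- V) \<subseteq> {1}"
    unfolding completely_regular_space_def by blast
  have "continuous_on UNIV f" "\<And>z. f z \<in> {0..1}"
    using f(1) by (auto simp: continuous_map_in_subtopology)
  then have "continuous_on UNIV (\<lambda>z. 1 - f z)" "\<And>z. 0 \<le> 1 - f z" "\<And>z. 1 - f z \<le> 1"
    by (auto intro!: continuous_intros)
  moreover have "1 - f z = 0" if "z \<notin> K" for z using that V(4) f(3) by auto
  ultimately show ?thesis using that[of "\<lambda>z. 1 - f z" K] f V by auto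
qed

text \<open>
  If \<open>d\<close> is uniformly close to a bump function at \<open>l\<close> supported in an open set, then
  \<open>|d| > 1/2\<close> describes a neighbourhood of \<open>l\<close> within that set.  So a countable dense subset of
  \<open>C0\<close> gives a countable base.
\<close>

lemma separable_C0_imp_second_countable:
  assumes lc: "locally_compact_space (euclidean :: 'l::t2_space topology)"
    and sep: "separable_C0 TYPE('l)"
  shows "second_countable (euclidean :: 'l topology)"
proof -
  obtain D where D: "D \<subseteq> (C0 :: ('l \<Rightarrow> complex) set)" "countable D"
    "\<And>a e. a \<in> C0 \<Longrightarrow> e > 0 \<Longrightarrow> \<exists>d\<in>D. \<forall>l. norm (a l - d l) \<le> e"
    using sep unfolding separable_C0_def by metis
  define B where "B = (\<lambda>d. {l. norm (d l) > 1/2}) ` D"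
  have "open V" if "V \<in> B" for V
  proof -
    obtain d where "d \<in> D" "V = {l. 1/2 < norm (d l)}" using \<open>V \<in> B\<close> by (auto simp: B_def)
    then show ?thesis using D(1) by (auto intro!: open_Collect_less continuous_intros simp: C0_def)
  qed
  moreover have "\<exists>V\<in>B. l \<in> V \<and> V \<subseteq> S" if lS: "open S" "l \<in> S" for l S
  proof -
    obtain f :: "'l \<Rightarrow> real" and K where
      f: "continuous_on UNIV f" "f l = 1" "compact K" "K \<subseteq> S" "\<And>z. z \<notin> K \<Longrightarrow> f z = 0"
      using exists_bump_function[OF lc lS] by metis
    then have "(\<lambda>z. complex_of_real (f z)) \<in> C0"
      using cc_on_C0 by (force simp: cc_on_def intro: continuous_intros)
    then obtain d where d: "d \<in> D" "\<And>z. norm (complex_of_real (f z) - d z) \<le> 1/4"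
      using D(3)[of _ "1/4"] by fastforce
    have "norm (d l) > 1/2"
      using d(2)[of l] norm_triangle_ineq2[of 1 "d l"] f(2) by simp
    moreover have "z \<in> S" if "norm (d z) > 1/2" for z
    proof (rule ccontr)
      assume "z \<notin> S"
      then have "f z = 0" using f by blast
      then show False using d(2)[of z] that by simp
    qed
    ultimately show ?thesis
      using d(1) unfolding B_def by (intro bexI[of _ "{z. norm (d z) > 1/2}"]) auto
  qed
  moreover have "countable B" using D(2) by (simp add: B_def)
  ultimately show ?thesis
    unfolding second_countable_def by (metis open_openin)
qed

lemma Lindelof_open:
  fixes \<V> :: "'l::topological_space set set"
  assumes "second_countable (euclidean :: 'l topology)" "\<And>V. V \<in> \<V> \<Longrightarrow> open V"
  obtains \<W> where "countable \<W>" "\<W> \<subseteq> \<V>" "\<Union>\<W> = \<Union>\<V>"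
proof -
  have "Lindelof_space (top_of_set (\<Union>\<V>))"
    using assms(1) by (simp add: second_countable_imp_Lindelof_space second_countable_subtopology)
  then show ?thesis
    using that Lindelof_spaceD[of "top_of_set (\<Union>\<V>)" \<V>] assms(2)
    by (metis (no_types, lifting) Union_upper openin_open_eq openin_subtopology_self topspace_euclidean_subtopology open_Union)
qed

text \<open>
  By the Lindelof property countably many bump functions \<open>f\<^sub>0, f\<^sub>1, \<dots>\<close> supported in \<open>S\<close> have no common
  zero in \<open>S\<close>; then \<open>min 1 (k \<Sum>\<^sub>i\<^sub><\<^sub>k f\<^sub>i)\<close> increases to the indicator.
\<close>

lemma open_indicator_increasing_limit:
  fixes S :: "'l::t2_space set"
  assumes lc: "locally_compact_space (euclidean :: 'l topology)"
    and sc: "second_countable (euclidean :: 'l topology)" and "open S"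
  obtains g :: "nat \<Rightarrow> 'l \<Rightarrow> real" and K where "incseq g" "\<And>i z. 0 \<le> g i z"
    "\<And>i. (\<lambda>z. complex_of_real (g i z)) \<in> cc_on (K i)" "\<And>i. compact (K i)" "\<And>i. K i \<subseteq> S"
    "\<And>z. (\<lambda>i. g i z) \<longlonglongrightarrow> indicator S z"
proof (cases "S = {}")
  case True
  then show ?thesis
    using that[of "\<lambda>_ _. 0" "\<lambda>_. {}"] by (auto simp: cc_on_def incseq_def)
next
  case False
  have "\<exists>f K. continuous_on UNIV f \<and> (\<forall>z. 0 \<le> f z) \<and> f l = (1::real) \<and> compact K \<and> K \<subseteq> S
      \<and> (\<forall>z. z \<notin> K \<longrightarrow> f z = 0)" if "l \<in> S" for l
    using exists_bump_function[OF lc \<open>open S\<close> that] by metis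
  then obtain f K where f: "\<And>l. l \<in> S \<Longrightarrow> continuous_on UNIV (f l) \<and> (\<forall>z. 0 \<le> f l z) \<and> f l l = (1::real)
      \<and> compact (K l) \<and> K l \<subseteq> S \<and> (\<forall>z. z \<notin> K l \<longrightarrow> f l z = 0)"
    by metis
  have fo: "open {z. f l z > 0}" if "l \<in> S" for l
    using f[OF that] by (intro open_Collect_less continuous_intros) auto
  obtain \<W> where W: "countable \<W>" "\<W> \<subseteq> (\<lambda>l. {z. f l z > 0}) ` S"
      "\<Union>\<W> = (\<Union>l\<in>S. {z. f l z > 0})"
    by (rule Lindelof_open[OF sc, of "(\<lambda>l. {z. f l z > 0}) ` S"]) (use fo in blast)+
  obtain I where I: "countable I" "I \<subseteq> S" "\<W> = (\<lambda>l. {z. f l z > 0}) ` I"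
    using W(1,2) by (meson countable_subset_image)
  have cover: "S \<subseteq> (\<Union>l\<in>I. {z. f l z > 0})"
    using W(3) I(3) f by force
  with False have "I \<noteq> {}" by auto
  then obtain x :: "nat \<Rightarrow> 'l" where x: "I = range x"
    using I(1) uncountable_def by blast
  then have xO: "x i \<in> S" for i using I(2) by auto
  note fx = f[OF xO]
  \<comment> \<open>The factor \<open>k\<close> pushes every positive partial sum up to the cut-off \<open>1\<close>.\<close>
  define g where "g k z = min 1 (real k * (\<Sum>i<k. f (x i) z))" for k z
  have sum0: "0 \<le> (\<Sum>i<k. f (x i) z)" for k z
    using fx by (intro sum_nonneg) auto
  show ?thesis
  proof (rule that[of g "\<lambda>k. \<Union>i<k. K (x i)"])
    have "g k z \<le> g (Suc k) z" for k z
    proof -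
      have "real k * (\<Sum>i<k. f (x i) z) \<le> real (Suc k) * (\<Sum>i<Suc k. f (x i) z)"
        using sum0[of z k] fx by (intro mult_mono) auto
      then show ?thesis unfolding g_def by linarith
    qed
    then show "incseq g" by (intro incseq_SucI) (auto simp: le_fun_def)
    show "0 \<le> g i z" for i z using sum0 by (simp add: g_def)
    show "compact (\<Union>i<k. K (x i))" for k using fx by (intro compact_UN) auto
    show "(\<Union>i<k. K (x i)) \<subseteq> S" for k using fx by auto
    show "(\<lambda>z. complex_of_real (g k z)) \<in> cc_on (\<Union>i<k. K (x i))" for k
    proof -
      have "g k z = 0" if "z \<notin> (\<Union>i<k. K (x i))" for z
        using that fx by (simp add: g_def)
      moreover have "continuous_on UNIV (g k)"
        unfolding g_def using fx by (intro continuous_intros) auto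
      ultimately show ?thesis by (auto simp: cc_on_def intro: continuous_intros)
    qed
    show "(\<lambda>k. g k z) \<longlonglongrightarrow> indicator S z" for z
    proof (cases "z \<in> S")
      case True
      then obtain j where j: "f (x j) z > 0" using cover x by auto
      obtain m where m: "real m * f (x j) z > 1" using j by (metis reals_Archimedean3)
      have "g k z = 1" if "k \<ge> max m (Suc j)" for k
      proof -
        have "f (x j) z \<le> (\<Sum>i<k. f (x i) z)"
          using that fx by (intro member_le_sum) auto
        then have "real m * f (x j) z \<le> real k * (\<Sum>i<k. f (x i) z)"
          using that j by (intro mult_mono) auto
        then show ?thesis using m by (simp add: g_def)
      qed
      then have "eventually (\<lambda>k. g k z = 1) sequentially"
        unfolding eventually_sequentially by blast
      then show ?thesis using True by (simp add: tendsto_eventually)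
    next
      case False
      then have "f (x i) z = 0" for i using fx by blast
      then show ?thesis using False by (simp add: g_def)
    qed
  qed
qed

section \<open>Densities tested locally against continuous functions\<close>

text \<open>
  This is Markov's inequality.
\<close>

lemma emeasure_level_set_finite:
  fixes f :: "'x \<Rightarrow> real"
  assumes "integrable M f" "c > 0"
  shows "emeasure M {l\<in>space M. c \<le> f l} < \<infinity>"
proof -
  have [measurable]: "f \<in> borel_measurable M" using assms by auto
  have "emeasure M {l\<in>space M. 1 \<le> ennreal (1/c) * ennreal (norm (f l))}
      \<le> ennreal (1/c) * (\<integral>\<^sup>+l. ennreal (norm (f l)) * indicator (space M) l \<partial>M)"
    by (intro nn_integral_Markov_inequality) auto
  also have "(\<integral>\<^sup>+l. ennreal (norm (f l)) * indicator (space M) l \<partial>M) = (\<integral>\<^sup>+l. ennreal (norm (f l)) \<partial>M)"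
    by (intro nn_integral_cong) auto
  also have "ennreal (1/c) * \<dots> < \<infinity>"
    using assms by (simp add: integrable_iff_bounded ennreal_mult_less_top)
  finally have fin: "emeasure M {l\<in>space M. 1 \<le> ennreal (1/c) * ennreal (norm (f l))} < \<infinity>" .
  have "{l\<in>space M. c \<le> f l} \<subseteq> {l\<in>space M. 1 \<le> ennreal (1/c) * ennreal (norm (f l))}"
    using assms(2) by (auto simp: ennreal_mult[symmetric] divide_simps)
  then have "emeasure M {l\<in>space M. c \<le> f l} \<le> emeasure M {l\<in>space M. 1 \<le> ennreal (1/c) * ennreal (norm (f l))}"
    by (intro emeasure_mono) auto
  with fin show ?thesis by (rule le_less_trans[rotated])
qed

text \<open>
  The assumption passes from test functions to open subsets of the sets \<open>N\<close> by monotone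
  convergence.  These open sets are stable under intersection and, as \<open>X\<close> is a union of countably
  many \<open>N\<close>, generate the Borel sets of \<open>X\<close>, so that uniqueness of measures applies.
\<close>

lemma density_eqI_local:
  fixes X :: "'l::t2_space set"
  assumes lc: "locally_compact_space (euclidean :: 'l topology)"
    and sc: "second_countable (euclidean :: 'l topology)"
    and X: "open X" and sets0: "sets M = sets (restrict_space borel X)" and sets: "sets \<nu> = sets (restrict_space borel X)"
    and w: "continuous_on X w" "\<And>l. l \<in> X \<Longrightarrow> 0 \<le> w l"
    and loc: "\<And>l. l \<in> X \<Longrightarrow> \<exists>N. open N \<and> l \<in> N \<and> N \<subseteq> X \<and> emeasure M N < \<infinity> \<and> emeasure \<nu> N < \<infinity> \<and>
      (\<forall>K a. compact K \<longrightarrow> K \<subseteq> N \<longrightarrow> a \<in> cc_on K \<longrightarrow>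
        (LINT z|M. complex_of_real (w z) * a z) = (LINT z|\<nu>. a z))"
  shows "\<nu> = density M (\<lambda>l. ennreal (w l))"
proof (cases "X = {}")
  case True
  then have "space \<nu> = {}" "space M = {}"
    using sets_eq_imp_space_eq[OF sets] sets_eq_imp_space_eq[OF sets0] by (auto simp: space_restrict_space)
  then show ?thesis by (intro measure_eqI) (auto simp: sets sets0 True sets_restrict_space)
next
  case False
  have spM: "space M = X" "space \<nu> = X"
    using sets_eq_imp_space_eq[OF sets] sets_eq_imp_space_eq[OF sets0] by (auto simp: space_restrict_space)
  have open_sets: "S \<in> sets M" "S \<in> sets \<nu>" if "open S" "S \<subseteq> X" for S
    using that by (auto simp: sets sets0 sets_restrict_space intro!: image_eqI[of _ _ S])
  have w_meas [measurable]: "w \<in> borel_measurable M"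
    using borel_measurable_continuous_on_restrict[OF w(1)] measurable_cong_sets[OF sets0] by blast
  define good where "good N \<longleftrightarrow> open N \<and> N \<subseteq> X \<and> emeasure M N < \<infinity> \<and> emeasure \<nu> N < \<infinity> \<and>
      (\<forall>K a. compact K \<longrightarrow> K \<subseteq> N \<longrightarrow> a \<in> cc_on K \<longrightarrow>
        (LINT z|M. complex_of_real (w z) * a z) = (LINT z|\<nu>. a z))" for N
  have eq: "emeasure \<nu> S = emeasure (density M (\<lambda>l. ennreal (w l))) S" if N: "good N" "open S" "S \<subseteq> N" for N S
  proof -
    obtain g K where g: "incseq g" "\<And>i z. 0 \<le> g i z"
      "\<And>i. (\<lambda>z. complex_of_real (g i z)) \<in> cc_on (K i)" "\<And>i. compact (K i)" "\<And>i. K i \<subseteq> S"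
      "\<And>z. (\<lambda>i. g i z) \<longlonglongrightarrow> indicator S z"
      using open_indicator_increasing_limit[OF lc sc N(2)] by metis
    have S: "S \<in> sets M" "S \<in> sets \<nu>" "N \<in> sets M" "N \<in> sets \<nu>" using N open_sets by (auto simp: good_def)
    have K: "K i \<subseteq> N" "K i \<subseteq> X" for i using g(5) N by (auto simp: good_def)
    have Kfin: "emeasure M (K i) < \<infinity>" "emeasure \<nu> (K i) < \<infinity>" for i
      using le_less_trans[OF emeasure_mono[OF K(1) S(3)]] le_less_trans[OF emeasure_mono[OF K(1) S(4)]] N(1)
      by (auto simp: good_def)
    have int: "integrable \<nu> (\<lambda>z. complex_of_real (g i z))" for i
      by (rule cc_on_integrable[OF g(3,4) K(2) sets Kfin(2)])
    have wcc: "(\<lambda>z. complex_of_real (w z) * complex_of_real (g i z)) \<in> cc_on (K i)" for i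
      by (rule cc_on_mult[OF g(3,4) K(2) X]) (intro continuous_intros w)
    have int0: "integrable M (\<lambda>z. complex_of_real (w z) * complex_of_real (g i z))" for i
      by (rule cc_on_integrable[OF wcc g(4) K(2) sets0 Kfin(1)])
    have rint: "integrable \<nu> (g i)" "integrable M (\<lambda>z. w z * g i z)" for i
      using int[of i] int0[of i] unfolding of_real_mult[symmetric] complex_of_real_integrable_eq .
    have Neq: "(LINT z|M. complex_of_real (w z) * a z) = (LINT z|\<nu>. a z)"
      if "compact L" "L \<subseteq> N" "a \<in> cc_on L" for L a
      using N(1) that unfolding good_def by simp
    have eq: "(\<integral>\<^sup>+z. ennreal (w z * g i z) \<partial>M) = (\<integral>\<^sup>+z. ennreal (g i z) \<partial>\<nu>)" for i
    proof -
      have "(LINT z|M. complex_of_real (w z * g i z)) = (LINT z|\<nu>. complex_of_real (g i z))"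
        unfolding of_real_mult by (rule Neq[OF g(4) K(1) g(3)])
      then have "(LINT z|M. w z * g i z) = (LINT z|\<nu>. g i z)"
        by (simp only: integral_complex_of_real of_real_eq_iff)
      moreover have "(\<integral>\<^sup>+z. ennreal (w z * g i z) \<partial>M) = ennreal (LINT z|M. w z * g i z)"
        using g(2) w(2) spM by (intro nn_integral_eq_integral[OF rint(2)] AE_I2) simp
      moreover have "(\<integral>\<^sup>+z. ennreal (g i z) \<partial>\<nu>) = ennreal (LINT z|\<nu>. g i z)"
        using g(2) by (intro nn_integral_eq_integral[OF rint(1)] AE_I2)
      ultimately show ?thesis by metis
    qed
    have "(\<lambda>i. \<integral>\<^sup>+z. ennreal (g i z) \<partial>\<nu>) \<longlonglongrightarrow> (\<integral>\<^sup>+z. ennreal (indicator S z) \<partial>\<nu>)"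
    proof (rule nn_integral_LIMSEQ)
      show "incseq (\<lambda>i z. ennreal (g i z))" using g(1) by (auto simp: incseq_def le_fun_def intro: ennreal_leI)
      show "(\<lambda>z. ennreal (g i z)) \<in> borel_measurable \<nu>" for i using rint(1)[of i] by measurable
      show "(\<lambda>i. ennreal (g i z)) \<longlonglongrightarrow> ennreal (indicator S z)" for z
        using g(6) by (intro tendsto_ennrealI)
    qed
    moreover have "(\<lambda>i. \<integral>\<^sup>+z. ennreal (w z * g i z) * indicator X z \<partial>M)
        \<longlonglongrightarrow> (\<integral>\<^sup>+z. ennreal (w z * indicator S z) * indicator X z \<partial>M)"
    proof (rule nn_integral_LIMSEQ)
      show "incseq (\<lambda>i z. ennreal (w z * g i z) * indicator X z)"
        using g(1) w(2) by (auto simp: incseq_def le_fun_def indicator_def intro!: ennreal_leI mult_left_mono)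
      show "(\<lambda>z. ennreal (w z * g i z) * indicator X z) \<in> borel_measurable M" for i
        using rint(2)[of i] open_sets[OF X] by measurable
      show "(\<lambda>i. ennreal (w z * g i z) * indicator X z) \<longlonglongrightarrow> ennreal (w z * indicator S z) * indicator X z" for z
        using g(6) by (cases "z \<in> X") (auto intro!: tendsto_ennrealI tendsto_mult_left)
    qed
    moreover have "(\<integral>\<^sup>+z. ennreal (w z * g i z) * indicator X z \<partial>M) = (\<integral>\<^sup>+z. ennreal (g i z) \<partial>\<nu>)" for i
      unfolding eq[symmetric] by (intro nn_integral_cong) (auto simp: spM)
    ultimately have "(\<integral>\<^sup>+z. ennreal (w z * indicator S z) * indicator X z \<partial>M) = (\<integral>\<^sup>+z. ennreal (indicator S z) \<partial>\<nu>)"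
      using LIMSEQ_unique by simp
    also have "(\<integral>\<^sup>+z. ennreal (indicator S z) \<partial>\<nu>) = emeasure \<nu> S"
      using S by (simp add: ennreal_indicator)
    also have "(\<integral>\<^sup>+z. ennreal (w z * indicator S z) * indicator X z \<partial>M) = (\<integral>\<^sup>+z. ennreal (w z) * indicator S z \<partial>M)"
      by (intro nn_integral_cong) (auto simp: spM indicator_def)
    also have "\<dots> = emeasure (density M (\<lambda>l. ennreal (w l))) S"
      using S by (subst emeasure_density) auto
    finally show ?thesis by simp
  qed
  have good_open: "open N" if "N \<in> {N. good N}" for N
    using that by (simp add: good_def)
  obtain \<W> where W: "countable \<W>" "\<W> \<subseteq> {N. good N}" "\<Union>\<W> = \<Union>{N. good N}"
    by (rule Lindelof_open[OF sc good_open])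
  have "\<Union>{N. good N} = X"
  proof (intro equalityI subsetI)
    fix l assume "l \<in> X"
    from loc[OF this] obtain N where "good N" "l \<in> N" unfolding good_def by metis
    then show "l \<in> \<Union>{N. good N}" by auto
  qed (auto simp: good_def)
  then have WX: "\<Union>\<W> = X" using W by simp
  with False have "\<W> \<noteq> {}" by auto
  then obtain A :: "nat \<Rightarrow> 'l set" where A: "range A = \<W>"
    using W(1) uncountable_def by metis
  define E where "E = {S. open S \<and> (\<exists>N. good N \<and> S \<subseteq> N)}"
  have gen: "sets (restrict_space borel X) = sigma_sets X E"
  proof
    show "sigma_sets X E \<subseteq> sets (restrict_space borel X)"
    proof -
      have "E \<subseteq> sets M" using open_sets by (auto simp: E_def good_def)
      then show ?thesis using sets.sigma_sets_subset[of E M] spM sets0 by simp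
    qed
    have "X \<in> sigma_sets UNIV {S. open S}" using X by (auto intro: sigma_sets.Basic)
    from sigma_sets_Int[OF this]
    have "sets (restrict_space borel X) = sigma_sets X ((\<inter>) X ` {S. open S})"
      unfolding sets_restrict_space by (simp add: sets_borel)
    also have "\<dots> \<subseteq> sigma_sets X E"
    proof (rule sigma_sets_mono, clarify)
      fix S :: "'l set" assume "open S"
      have "X \<inter> S = (\<Union>i. S \<inter> A i)" using WX A by auto
      moreover have "S \<inter> A i \<in> E" for i
      proof -
        have "good (A i)" using A W(2) by auto
        then show ?thesis using \<open>open S\<close> by (auto simp: E_def good_def)
      qed
      ultimately show "X \<inter> S \<in> sigma_sets X E"
        by (metis sigma_sets.Basic sigma_sets.Union)
    qed
    finally show "sets (restrict_space borel X) \<subseteq> sigma_sets X E" .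
  qed
  show ?thesis
  proof (rule measure_eqI_generator_eq[of E X _ _ A])
    show "Int_stable E" unfolding Int_stable_def E_def by (auto intro: open_Int)
    show "E \<subseteq> Pow X" by (auto simp: E_def good_def)
    show "emeasure \<nu> S = emeasure (density M (\<lambda>l. ennreal (w l))) S" if "S \<in> E" for S
      using that eq by (auto simp: E_def)
    show "sets \<nu> = sigma_sets X E" "sets (density M (\<lambda>l. ennreal (w l))) = sigma_sets X E"
      using gen sets sets0 by auto
    have Agood: "good (A i)" for i using A W(2) by auto
    then show "range A \<subseteq> E" using good_open unfolding E_def by blast
    show "(\<Union>i. A i) = X" using A WX by auto
    show "emeasure \<nu> (A i) \<noteq> \<infinity>" for i using Agood[of i] by (auto simp: good_def)
  qed
qed

section \<open>Modules of sections and local orthonormal frames\<close>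

text \<open>
  The module over the continuous functions on \<open>N\<close> generated by \<open>G\<close>.  Gram-Schmidt applied to a
  frame drawn from \<open>G\<close> stays inside it, although it leaves the linear span of \<open>G\<close>.
\<close>

inductive_set section_module :: "('x \<Rightarrow> 'f::complex_vector) set \<Rightarrow> 'x::topological_space set \<Rightarrow> ('x \<Rightarrow> 'f) set"
  for G N where
  generator: "x \<in> G \<Longrightarrow> continuous_on N c \<Longrightarrow> (\<lambda>l. c l *\<^sub>C x l) \<in> section_module G N"
| add: "x \<in> section_module G N \<Longrightarrow> y \<in> section_module G N \<Longrightarrow> (\<lambda>l. x l + y l) \<in> section_module G N"

lemma section_module_mono:
  assumes "x \<in> section_module G N" "N' \<subseteq> N"
  shows "x \<in> section_module G N'"
  using assms(1)
  by induction (use assms(2) in \<open>auto intro: section_module.intros continuous_on_subset\<close>)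

lemma section_module_scale:
  assumes "x \<in> section_module G N" "continuous_on N d"
  shows "(\<lambda>l. d l *\<^sub>C x l) \<in> section_module G N"
  using assms(1)
proof induction
  case (generator x c)
  then have "(\<lambda>l. (d l * c l) *\<^sub>C x l) \<in> section_module G N"
    by (intro section_module.generator continuous_intros assms)
  then show ?case by (simp add: scaleC_scaleC)
qed (auto simp: scaleC_add_right intro: section_module.add)

lemma section_module_base: "x \<in> G \<Longrightarrow> x \<in> section_module G N"
  using section_module.generator[of x G N "\<lambda>_. 1"] by (simp add: scaleC_one)

lemma section_module_add_sum:
  fixes k :: nat
  assumes "y \<in> section_module G N" "\<And>i. i < k \<Longrightarrow> x i \<in> section_module G N"
  shows "(\<lambda>l. y l + (\<Sum>i<k. x i l)) \<in> section_module G N"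
  using assms(2)
proof (induction k)
  case (Suc k)
  then have "(\<lambda>l. (y l + (\<Sum>i<k. x i l)) + x k l) \<in> section_module G N"
    by (intro section_module.add[of "\<lambda>l. y l + (\<Sum>i<k. x i l)"]) auto
  then show ?case by (simp add: add.assoc)
qed (simp add: assms)

lemma section_module_in_fibre:
  assumes "x \<in> section_module G N" "\<And>x. x \<in> G \<Longrightarrow> x l \<in> V" "complex_vector.subspace V"
  shows "x l \<in> V"
  using assms(1)
  by induction (auto simp: assms complex_vector.subspace_scale complex_vector.subspace_add)

lemma section_module_continuous_cinner:
  assumes G: "\<And>x y. x \<in> G \<Longrightarrow> y \<in> G \<Longrightarrow> continuous_on N (\<lambda>l. cinner (x l) (y l))"
    and x: "x \<in> section_module G N" and y: "y \<in> section_module G N"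
  shows "continuous_on N (\<lambda>l. cinner (x l) (y l))"
  using x
proof induction
  case (generator x c)
  from y have "continuous_on N (\<lambda>l. cinner (x l) (y l))"
    by induction
      (auto simp: cinner_scaleC_right cinner_add_right intro!: continuous_intros G generator)
  then show ?case by (auto simp: cinner_scaleC_left intro!: continuous_intros generator)
qed (auto simp: cinner_add_left intro!: continuous_intros)

lemma continuous_on_norm_of_cinner:
  assumes "continuous_on N (\<lambda>l. cinner (x l) (x l))"
  shows "continuous_on N (\<lambda>l. norm (x l))"
proof -
  have "continuous_on N (\<lambda>l. sqrt (Re (cinner (x l) (x l))))"
    by (intro continuous_intros assms)
  then show ?thesis by (simp add: cinner_self del: of_real_power)
qed

text \<open>
  Gram-Schmidt, one vector at a time.  As long as \<open>k\<close> is below the dimension at \<open>l\<close>, some generator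
  is not reproduced by the vectors found so far at \<open>l\<close>.  Subtracting its projection leaves a section
  that is nonzero at \<open>l\<close> and hence on a smaller neighbourhood, where it can be normalized.
\<close>

lemma exists_local_orthonormal_frame:
  fixes X :: "'x::topological_space set" and V :: "'x \<Rightarrow> 'f::complex_inner set"
  assumes X: "open X" "l \<in> X"
    and V: "\<And>z. z \<in> X \<Longrightarrow> complex_vector.subspace (V z)"
    and G: "\<And>x z. x \<in> G \<Longrightarrow> z \<in> X \<Longrightarrow> x z \<in> V z" "V l \<subseteq> (\<lambda>x. x l) ` G"
    and cont: "\<And>x y. x \<in> G \<Longrightarrow> y \<in> G \<Longrightarrow> continuous_on X (\<lambda>z. cinner (x z) (y z))"
    and k: "k \<le> complex_vector.dim (V l)"
  shows "\<exists>N e. open N \<and> l \<in> N \<and> N \<subseteq> X \<and> (\<forall>i<k. e i \<in> section_module G N) \<and>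
    (\<forall>z\<in>N. orthonormal_family k (\<lambda>i. e i z))"
  using k
proof (induction k)
  case 0
  then show ?case using X by (auto simp: orthonormal_family_def)
next
  case (Suc k)
  then obtain N e where N: "open N" "l \<in> N" "N \<subseteq> X"
    and e: "\<And>i. i < k \<Longrightarrow> e i \<in> section_module G N" "\<And>z. z \<in> N \<Longrightarrow> orthonormal_family k (\<lambda>i. e i z)"
    by (metis Suc_leD)
  have eV: "e i z \<in> V z" if "i < k" "z \<in> N" for i z
  proof (rule section_module_in_fibre[OF e(1)[OF that(1)]])
    have "z \<in> X" using that(2) N(3) by auto
    then show "complex_vector.subspace (V z)" "\<And>x. x \<in> G \<Longrightarrow> x z \<in> V z"
      using V G(1) by auto
  qed
  have contN: "continuous_on N (\<lambda>z. cinner (x z) (y z))"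
    if "x \<in> section_module G N" "y \<in> section_module G N" for x y
    by (rule section_module_continuous_cinner[OF _ that]) (rule continuous_on_subset[OF cont N(3)])
  obtain w where w: "w \<in> V l" "w \<noteq> (\<Sum>i<k. cinner (e i l) w *\<^sub>C e i l)"
    using orthonormal_dim_eqI[OF e(2)[OF N(2)] eV[OF _ N(2)]] Suc.prems
    by (metis Suc_n_not_le_n)
  then obtain h where h: "h \<in> G" "h l = w" using G(2) by auto
  define y where "y z = h z + (\<Sum>i<k. (- cinner (e i z) (h z)) *\<^sub>C e i z)" for z
  have y: "y \<in> section_module G N"
    unfolding y_def
    by (intro section_module_add_sum section_module_base[OF h(1)] section_module_scale e
        continuous_intros contN)
  have orth: "cinner (e i z) (y z) = 0" if "i < k" "z \<in> N" for i z
    unfolding y_def cinner_add_right orthonormal_coefficient[OF e(2)[OF that(2)] that(1)] by simp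
  then have orth': "cinner (y z) (e i z) = 0" if "i < k" "z \<in> N" for i z
    using that cinner_commute by (metis complex_cnj_zero)
  have yl: "y l \<noteq> 0"
    using w(2) by (simp add: y_def h(2) sum_negf)
  define N' where "N' = N \<inter> (\<lambda>z. cinner (y z) (y z)) -` (- {0})"
  have "open N'"
    unfolding N'_def by (intro continuous_open_preimage contN y N) auto
  moreover have "l \<in> N'" using N yl by (auto simp: N'_def cinner_self)
  moreover have N'N: "N' \<subseteq> N" by (auto simp: N'_def)
  define e' where "e' i = (if i = k then (\<lambda>z. complex_of_real (1 / norm (y z)) *\<^sub>C y z) else e i)" for i
  have y0: "y z \<noteq> 0" if "z \<in> N'" for z using that by (auto simp: N'_def)
  have "e' i \<in> section_module G N'" if "i < Suc k" for i
  proof (cases "i = k")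
    case True
    have ny: "continuous_on N' (\<lambda>z. norm (y z))"
      by (intro continuous_on_norm_of_cinner continuous_on_subset[OF contN[OF y y] N'N])
    have "continuous_on N' (\<lambda>z. complex_of_real (1 / norm (y z)))"
      using y0 by (intro continuous_on_of_real continuous_on_divide continuous_on_const ny) auto
    then show ?thesis
      using True section_module_scale[OF section_module_mono[OF y N'N]] by (simp add: e'_def)
  next
    case False
    then show ?thesis using that section_module_mono[OF e(1) N'N] by (simp add: e'_def)
  qed
  moreover have "orthonormal_family (Suc k) (\<lambda>i. e' i z)" if "z \<in> N'" for z
  proof -
    have zN: "z \<in> N" using that N'N by auto
    show ?thesis
      unfolding orthonormal_family_def
    proof (intro allI impI)
      fix i j assume "i < Suc k" "j < Suc k"
      then consider "i < k" "j < k" | "i < k" "j = k" | "i = k" "j < k" | "i = k" "j = k" by linarith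
      then show "cinner (e' i z) (e' j z) = (if i = j then 1 else 0)"
      proof cases
        case 1
        then show ?thesis using e(2)[OF zN] by (simp add: e'_def orthonormal_family_def)
      next
        case 4
        then show ?thesis using y0[OF that]
          by (simp add: e'_def cinner_scaleC_left cinner_scaleC_right cinner_self norm_scaleC norm_divide power2_eq_square)
      qed (use orth[OF _ zN] orth'[OF _ zN] in \<open>auto simp: e'_def cinner_scaleC_left cinner_scaleC_right\<close>)
    qed
  qed
  ultimately show ?case
    using N(3) N'N by (intro exI[of _ N'] exI[of _ e']) auto
qed

section \<open>Continuous fields carrying a spectral decomposition\<close>

lemma continuous_field_cinner:
  assumes f: "continuous_field X F G" and x: "x \<in> G" and y: "y \<in> G"
  shows "continuous_on X (\<lambda>l. cinner (x l) (y l))"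
proof -
  have n: "continuous_on X (\<lambda>l. norm (x l))" if "x \<in> G" for x
    using f that by (simp add: continuous_field_def)
  have i: "continuous_on X (\<lambda>l. inner (x l) (y l))" if "x \<in> G" "y \<in> G" for x y
  proof -
    have "(\<lambda>l. x l + y l) \<in> G" using f that by (simp add: continuous_field_def)
    note n[OF this]
    then show ?thesis
      unfolding dot_norm
      by (intro continuous_on_divide continuous_on_diff continuous_on_power continuous_on_const n[OF that(1)] n[OF that(2)])
        simp_all
  qed
  have s: "(\<lambda>l. (-\<i>) *\<^sub>C y l) \<in> G" using f y unfolding continuous_field_def by blast
  show ?thesis
    unfolding cinner_eq_inner Complex_eq
    by (intro continuous_on_add continuous_on_mult continuous_on_const continuous_on_of_real i x y s)
qed

lemma spectral_decomposition_finite_nhd: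
  assumes f: "continuous_field X F G" and sd: "spectral_decomposition \<pi> X F G D s \<mu>"
    and X: "open X" "l \<in> X" and h: "h \<in> D" "s h l \<noteq> 0"
  obtains N where "open N" "l \<in> N" "N \<subseteq> X" "emeasure \<mu> N < \<infinity>"
proof -
  have sh: "s h \<in> G" and sets: "sets \<mu> = sets (restrict_space borel X)"
    and int: "integrable \<mu> (\<lambda>l. cinner (s h l) (s h l))"
    using sd h(1) by (auto simp: spectral_decomposition_def)
  have sp: "space \<mu> = X"
    using sets_eq_imp_space_eq[OF sets] by (simp add: space_restrict_space)
  have "integrable \<mu> (\<lambda>l. Re (cinner (s h l) (s h l)))"
    by (rule integrable_Re[OF int])
  then have int: "integrable \<mu> (\<lambda>l. (norm (s h l))\<^sup>2)"
    by (simp add: cinner_self del: of_real_power)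
  define c where "c = (norm (s h l))\<^sup>2 / 2"
  have c: "c > 0" "c < (norm (s h l))\<^sup>2" using h(2) by (auto simp: c_def)
  define N where "N = X \<inter> (\<lambda>l. norm (s h l)) -` {r. c < r\<^sup>2}"
  have "open N"
    unfolding N_def
  proof (rule continuous_open_preimage)
    show "continuous_on X (\<lambda>l. norm (s h l))" using f sh by (simp add: continuous_field_def)
    show "open {r::real. c < r\<^sup>2}" by (intro open_Collect_less continuous_intros)
  qed fact
  moreover have "l \<in> N" using X c by (simp add: N_def)
  moreover have "emeasure \<mu> N \<le> emeasure \<mu> {l\<in>space \<mu>. c \<le> (norm (s h l))\<^sup>2}"
  proof (rule emeasure_mono)
    show "N \<subseteq> {l\<in>space \<mu>. c \<le> (norm (s h l))\<^sup>2}" by (auto simp: N_def sp)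
    show "{l\<in>space \<mu>. c \<le> (norm (s h l))\<^sup>2} \<in> sets \<mu>"
      using borel_measurable_integrable[OF int] by measurable
  qed
  then have "emeasure \<mu> N < \<infinity>"
    using emeasure_level_set_finite[OF int c(1)] by (rule le_less_trans)
  ultimately show ?thesis using that by (auto simp: N_def)
qed

text \<open>
  Quantitative continuity of \<open>(p, p') \<mapsto> cnj p * p'\<close> on a bounded set, with a bound for the first
  pair only: the pair \<open>(q, q')\<close> is known just through its distance from it.
\<close>

lemma norm_cnj_mult_diff_le:
  assumes "norm p \<le> Q" "norm p' \<le> Q" "norm (p - q) \<le> d" "norm (p' - q') \<le> d" "d \<le> 1"
  shows "norm (cnj p * p' - cnj q * q') \<le> d * (2 * Q + 1)"
proof -
  have nonneg: "0 \<le> Q" "0 \<le> d"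
    using assms(1,3) norm_ge_zero order_trans by blast+
  have eq: "cnj p * p' - cnj q * q' = cnj p * (p' - q') + cnj (p - q) * p' - cnj (p - q) * (p' - q')"
    by (simp add: algebra_simps)
  have "norm (cnj p * p' - cnj q * q')
      \<le> norm (cnj p * (p' - q')) + norm (cnj (p - q) * p') + norm (cnj (p - q) * (p' - q'))"
    unfolding eq
    using norm_triangle_ineq4[of "cnj p * (p' - q') + cnj (p - q) * p'" "cnj (p - q) * (p' - q')"]
      norm_triangle_ineq[of "cnj p * (p' - q')" "cnj (p - q) * p'"] by linarith
  also have "\<dots> \<le> Q * d + d * Q + d * d"
    unfolding norm_mult complex_mod_cnj
    using assms nonneg by (intro add_mono mult_mono) auto
  also have "d * d \<le> d * 1"
    using assms(5) nonneg by (intro mult_left_mono)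
  finally show ?thesis by (simp add: algebra_simps)
qed

section \<open>The asymptotic identity for the given sections\<close>

locale asymptotic_spectral_model =
  fixes \<pi>0 :: "('l::t2_space \<Rightarrow> complex) \<Rightarrow> 'h0::complex_hilbert \<Rightarrow> 'h0"
    and \<pi> :: "('l \<Rightarrow> complex) \<Rightarrow> 'h::complex_hilbert \<Rightarrow> 'h"
    and U :: "real \<Rightarrow> 'h0 \<Rightarrow> 'h0"
    and W :: "'h0 \<Rightarrow> 'h"
    and \<Lambda>0 :: "'l set"
    and F0 :: "'l \<Rightarrow> 'f::complex_inner set"
    and \<Gamma>0 :: "('l \<Rightarrow> 'f) set"
    and D0 :: "'h0 set"
    and s0 :: "'h0 \<Rightarrow> 'l \<Rightarrow> 'f"
    and \<mu>0 :: "'l measure"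
    and Ufib :: "real \<Rightarrow> 'l \<Rightarrow> 'f \<Rightarrow> 'f"
    and F :: "'l \<Rightarrow> 'g::complex_inner set"
    and \<Gamma> :: "('l \<Rightarrow> 'g) set"
    and D :: "'h set"
    and s :: "'h \<Rightarrow> 'l \<Rightarrow> 'g"
    and \<mu> :: "'l measure"
    and C :: "'l \<Rightarrow> 'g \<Rightarrow> 'f"
  assumes asym: "asymptotically_contained_via \<pi>0 \<pi> U W"
    and A: "assumption_A \<pi>0 \<Lambda>0 F0 \<Gamma>0 D0 s0 \<mu>0"
    and B: "assumption_B \<Lambda>0 F0 \<Gamma>0 D0 s0 U Ufib"
    and C: "assumption_C \<pi> F \<Gamma> D s \<mu> D0 U W"
    and D: "assumption_D \<Lambda>0 F0 \<Gamma>0 D0 s0 F \<Gamma> s U W C"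
begin

lemma open_base: "open \<Lambda>0" and bundle0: "hermitian_bundle \<Lambda>0 F0 \<Gamma>0"
  and spectral0: "spectral_decomposition \<pi>0 \<Lambda>0 F0 \<Gamma>0 D0 s0 \<mu>0"
  and fibre0_image: "l \<in> \<Lambda>0 \<Longrightarrow> F0 l = (\<lambda>h. s0 h l) ` D0"
  using A by (auto simp: assumption_A_def)

lemma field0: "continuous_field \<Lambda>0 F0 \<Gamma>0" and trivial0: "locally_trivial \<Lambda>0 F0 \<Gamma>0"
  and finite0: "l \<in> \<Lambda>0 \<Longrightarrow> finite_dimensional (F0 l)"
  using bundle0 by (auto simp: hermitian_bundle_def)

lemma fibre0_subspace: "l \<in> \<Lambda>0 \<Longrightarrow> complex_vector.subspace (F0 l)"
  using field0 by (simp add: continuous_field_def)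

lemma s0_section: "h \<in> D0 \<Longrightarrow> s0 h \<in> \<Gamma>0"
  and sets_\<mu>0: "sets \<mu>0 = sets (restrict_space borel \<Lambda>0)"
  and \<pi>0_integral: "h \<in> D0 \<Longrightarrow> g \<in> D0 \<Longrightarrow> a \<in> C0 \<Longrightarrow>
    cinner h (\<pi>0 a g) = (LINT l|\<mu>0. cinner (s0 h l) (s0 g l) * a l)"
  using spectral0 by (auto simp: spectral_decomposition_def)

lemma s0_fibre: "h \<in> D0 \<Longrightarrow> l \<in> \<Lambda>0 \<Longrightarrow> s0 h l \<in> F0 l"
  using fibre0_image by auto

lemma U_invariant: "h \<in> D0 \<Longrightarrow> U t h \<in> D0"
  and Ufib_unitary: "l \<in> \<Lambda>0 \<Longrightarrow> unitary_between (F0 l) (F0 l) (Ufib t l)"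
  and s0_U: "h \<in> D0 \<Longrightarrow> l \<in> \<Lambda>0 \<Longrightarrow> s0 (U t h) l = Ufib t l (s0 h l)"
  using B by (auto simp: assumption_B_def continuous_unitary_action_def)

lemma spectral: "spectral_decomposition \<pi> UNIV F \<Gamma> D s \<mu>"
  and dim_one: "complex_vector.dim (F l) = 1"
  and eventually_W_U: "h \<in> D0 \<Longrightarrow> \<forall>\<^sub>F t in at_top. W (U t h) \<in> D"
  and field: "continuous_field UNIV F \<Gamma>"
  using C by (auto simp: assumption_C_def hermitian_bundle_def)

lemma fibre_subspace: "complex_vector.subspace (F l)"
  and section_fibre: "v \<in> \<Gamma> \<Longrightarrow> v l \<in> F l"
  using field by (auto simp: continuous_field_def)

lemma s_section: "h \<in> D \<Longrightarrow> s h \<in> \<Gamma>"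
  and sets_\<mu>: "sets \<mu> = sets (restrict_space borel UNIV)"
  and s_integrable: "h \<in> D \<Longrightarrow> g \<in> D \<Longrightarrow> integrable \<mu> (\<lambda>l. cinner (s h l) (s g l))"
  and \<pi>_integral: "h \<in> D \<Longrightarrow> g \<in> D \<Longrightarrow> a \<in> C0 \<Longrightarrow>
    cinner h (\<pi> a g) = (LINT l|\<mu>. cinner (s h l) (s g l) * a l)"
  using spectral by (auto simp: spectral_decomposition_def)

lemma C_linear: "l \<in> \<Lambda>0 \<Longrightarrow> clinear_on (F l) (C l)"
  and C_fibre: "l \<in> \<Lambda>0 \<Longrightarrow> v \<in> F l \<Longrightarrow> C l v \<in> F0 l"
  and C_inj: "l \<in> \<Lambda>0 \<Longrightarrow> inj_on (C l) (F l)"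
  using D by (auto simp: assumption_D_def)

lemma C_section: "v \<in> \<Gamma> \<Longrightarrow> (\<lambda>l. C l (v l)) \<in> \<Gamma>0"
proof -
  assume v: "v \<in> \<Gamma>"
  have "v \<in> sections_over F \<Gamma> \<Lambda>0"
    unfolding sections_over_def
  proof (safe)
    fix l e assume "l \<in> \<Lambda>0" "(0::real) < e"
    then show "\<exists>y\<in>\<Gamma>. \<exists>N. openin (top_of_set \<Lambda>0) N \<and> l \<in> N \<and> (\<forall>z\<in>N. norm (v z - y z) \<le> e)"
      using v by (intro bexI[of _ v] exI[of _ \<Lambda>0]) auto
  qed (simp add: section_fibre v)
  then show ?thesis using D by (auto simp: assumption_D_def)
qed

lemma C_nonzero:
  assumes "l \<in> \<Lambda>0" "v \<in> F l" "v \<noteq> 0"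
  shows "C l v \<noteq> 0"
proof
  assume "C l v = 0"
  have "C l (0 *\<^sub>C v) = 0 *\<^sub>C C l v"
    using C_linear[OF assms(1)] assms(2) unfolding clinear_on_def by blast
  then have "C l 0 = C l v" using \<open>C l v = 0\<close> by simp
  moreover have "0 \<in> F l" by (rule complex_vector.subspace_0[OF fibre_subspace])
  ultimately show False using C_inj[OF assms(1)] assms by (auto simp: inj_on_def)
qed

text \<open>
  The supremum condition on \<open>C\<close>, in the pointwise uniform form used for estimating integrals.
\<close>

lemma uniform_comparison:
  assumes "h \<in> D0" "v \<in> \<Gamma>" "compact K" "K \<subseteq> \<Lambda>0" "d > 0"
  shows "\<forall>\<^sub>F t in at_top. \<forall>l\<in>K.
    norm (cinner (C l (v l)) (s0 (U t h) l) - cinner (v l) (s (W (U t h)) l)) < d"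
proof -
  have "((\<lambda>t. SUP l\<in>K. ennreal (norm
          (cinner (C l (v l)) (s0 (U t h) l) - cinner (v l) (s (W (U t h)) l)))) \<longlongrightarrow> 0) at_top"
    using D assms by (auto simp: assumption_D_def)
  then have "\<forall>\<^sub>F t in at_top. (SUP l\<in>K. ennreal (norm
          (cinner (C l (v l)) (s0 (U t h) l) - cinner (v l) (s (W (U t h)) l)))) < ennreal d"
    using assms(5) by (intro order_tendstoD(2)) auto
  then show ?thesis
  proof eventually_elim
    case (elim t)
    show ?case
    proof
      fix l assume "l \<in> K"
      then have "ennreal (norm (cinner (C l (v l)) (s0 (U t h) l) - cinner (v l) (s (W (U t h)) l)))
          \<le> (SUP l\<in>K. ennreal (norm (cinner (C l (v l)) (s0 (U t h) l) - cinner (v l) (s (W (U t h)) l))))"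
        by (intro SUP_upper)
      also note elim
      finally show "norm (cinner (C l (v l)) (s0 (U t h) l) - cinner (v l) (s (W (U t h)) l)) < d"
        using assms(5) by (simp add: ennreal_less_iff)
    qed
  qed
qed

text \<open>
  Asymptotic containment, rewritten with the two spectral decompositions.  For small \<open>t\<close> the vectors
  \<open>W (U t h)\<close> may lie outside \<open>D\<close>, which a limit does not see.
\<close>

lemma vector_state_limit:
  assumes "a \<in> C0" "h \<in> D0" "g \<in> D0"
  shows "((\<lambda>t. LINT l|\<mu>. cinner (s (W (U t h)) l) (s (W (U t g)) l) * a l)
    \<longlongrightarrow> (LINT l|\<mu>0. cinner (s0 h l) (s0 g l) * a l)) at_top"
proof -
  have "((\<lambda>t. cinner h (\<pi>0 a g) - (cinner h (\<pi>0 a g) - cinner (W (U t h)) (\<pi> a (W (U t g)))))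
      \<longlongrightarrow> cinner h (\<pi>0 a g) - 0) at_top"
    using asym assms(1) unfolding asymptotically_contained_via_def
    by (intro tendsto_diff tendsto_const) blast
  then have lim: "((\<lambda>t. cinner (W (U t h)) (\<pi> a (W (U t g)))) \<longlongrightarrow> cinner h (\<pi>0 a g)) at_top"
    by simp
  moreover have "\<forall>\<^sub>F t in at_top. cinner (W (U t h)) (\<pi> a (W (U t g)))
      = (LINT l|\<mu>. cinner (s (W (U t h)) l) (s (W (U t g)) l) * a l)"
    using eventually_W_U[OF assms(2)] eventually_W_U[OF assms(3)]
    by eventually_elim (simp add: \<pi>_integral assms(1))
  ultimately show ?thesis
    using tendsto_cong \<pi>0_integral[OF assms(2,3,1)] by fastforce
qed

text \<open>
  For \<open>x = s0 h\<close> this is \<open>\<langle>C v, (U\<^sub>t h)\<rangle>\<close>, which is what \<open>\<langle>v, (W U\<^sub>t h)\<rangle>\<close> looks like for large \<open>t\<close>.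
  The fibrewise action gives it a meaning for sections \<open>x\<close> that do not come from a vector \<open>h\<close>.
\<close>

definition shadow :: "('l \<Rightarrow> 'g) \<Rightarrow> real \<Rightarrow> ('l \<Rightarrow> 'f) \<Rightarrow> 'l \<Rightarrow> complex"
  where "shadow v t x l = cinner (C l (v l)) (Ufib t l (x l))"

text \<open>
  With \<open>b = |v|\<^sup>2 a\<close>, the matrix coefficients of \<open>\<pi> b\<close> at \<open>W U\<^sub>t h\<close>, \<open>W U\<^sub>t g\<close> are integrals of
  \<open>cnj p\<^sub>h * p\<^sub>g * a\<close> with \<open>p\<^sub>h = \<langle>v, (W U\<^sub>t h)\<rangle>\<close>.  The shadows are bounded on \<open>K\<close> independently of \<open>t\<close>
  because the fibre action is unitary, and they approach \<open>p\<^sub>h\<close> uniformly on \<open>K\<close>, a set of finite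
  measure.  So replacing \<open>p\<close> by the shadows does not change the limit.
\<close>

lemma generator_limit:
  assumes N: "open N" "N \<subseteq> \<Lambda>0" and v: "v \<in> \<Gamma>" "\<And>l. l \<in> N \<Longrightarrow> v l \<noteq> 0"
    and fin: "emeasure \<mu> N < \<infinity>" and K: "compact K" "K \<subseteq> N" and a: "a \<in> cc_on K"
    and h: "h \<in> D0" "g \<in> D0"
  shows "((\<lambda>t. LINT l|\<mu>. cnj (shadow v t (s0 h) l) * shadow v t (s0 g) l * a l)
    \<longlongrightarrow> (LINT l|\<mu>0. complex_of_real ((norm (v l))\<^sup>2) * cinner (s0 h l) (s0 g l) * a l)) at_top"
proof -
  define b where "b l = complex_of_real ((norm (v l))\<^sup>2) * a l" for l
  define p where "p h t l = cinner (v l) (s (W (U t h)) l)" for h t l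
  have K\<Lambda>: "K \<subseteq> \<Lambda>0" using N K by auto
  have vn: "continuous_on UNIV (\<lambda>l. norm (v l))"
    using field v by (simp add: continuous_field_def)
  have b: "b \<in> cc_on K"
    unfolding b_def
    by (intro cc_on_mult[OF a K N(1)] continuous_on_of_real continuous_on_power
        continuous_on_subset[OF vn]) auto
  have K_meas: "K \<in> sets \<mu>" using K(1) by (simp add: sets_\<mu> borel_compact)
  have "N \<in> sets \<mu>" using N(1) by (simp add: sets_\<mu>)
  then have finK: "emeasure \<mu> K < \<infinity>"
    using le_less_trans[OF emeasure_mono[OF K(2)] fin] by simp
  have shadow_eq: "shadow v t (s0 h) l = cinner (C l (v l)) (s0 (U t h) l)" if "l \<in> K" "h \<in> D0" for t h l
    using that K\<Lambda> by (auto simp: shadow_def s0_U)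
  have shadow_a: "cnj (shadow v t (s0 h) l) * shadow v t (s0 g) l * a l =
      (cnj (cinner (C l (v l)) (s0 (U t h) l)) * cinner (C l (v l)) (s0 (U t g) l)) * a l" for t l
    using a shadow_eq h by (cases "l \<in> K") (auto simp: cc_on_def)
  have shadow_int: "integrable \<mu> (\<lambda>l. cnj (shadow v t (s0 h) l) * shadow v t (s0 g) l * a l)" for t
    unfolding shadow_a
  proof (rule cc_on_integrable[OF _ K(1) subset_UNIV sets_\<mu> finK], rule cc_on_mult[OF a K N(1)])
    have "continuous_on N (\<lambda>l. cinner (C l (v l)) (s0 (U t h) l))" if "h \<in> D0" for h
      using that N(2)
      by (intro continuous_on_subset[OF continuous_field_cinner[OF field0 C_section[OF v(1)] s0_section[OF U_invariant]]])
    then show "continuous_on N (\<lambda>l. cnj (cinner (C l (v l)) (s0 (U t h) l)) * cinner (C l (v l)) (s0 (U t g) l))"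
      using h by (intro continuous_intros) auto
  qed
  have p_a: "cinner (s (W (U t h)) l) (s (W (U t g)) l) * b l = cnj (p h t l) * p g t l * a l"
    if "W (U t h) \<in> D" "W (U t g) \<in> D" for t l
  proof (cases "l \<in> K")
    case True
    then have "v l \<noteq> 0" using v K by auto
    from one_dimensional_cinner[OF dim_one fibre_subspace section_fibre[OF v(1)] this
        section_fibre[OF s_section[OF that(1)]] section_fibre[OF s_section[OF that(2)]]]
    show ?thesis by (simp add: b_def p_def)
  qed (use a in \<open>simp add: b_def cc_on_def\<close>)
  obtain Ba where Ba: "0 \<le> Ba" "\<And>l. norm (a l) \<le> Ba" using cc_on_bounded[OF a K(1)] by blast
  obtain Bb where Bb: "0 \<le> Bb" "\<And>l. norm (b l) \<le> Bb" using cc_on_bounded[OF b K(1)] by blast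
  have b_meas: "b \<in> borel_measurable \<mu>"
    using cc_on_integrable[OF b K(1) subset_UNIV sets_\<mu> finK] by auto
  have p_int: "integrable \<mu> (\<lambda>l. cnj (p h t l) * p g t l * a l)"
    if "W (U t h) \<in> D" "W (U t g) \<in> D" for t
    unfolding p_a[OF that, symmetric]
  proof (rule Bochner_Integration.integrable_bound)
    note si = s_integrable[OF that]
    show "integrable \<mu> (\<lambda>l. Bb * norm (cinner (s (W (U t h)) l) (s (W (U t g)) l)))"
      by (intro integrable_mult_right integrable_norm si)
    show "(\<lambda>l. cinner (s (W (U t h)) l) (s (W (U t g)) l) * b l) \<in> borel_measurable \<mu>"
      using borel_measurable_integrable[OF si] b_meas by measurable
    show "AE l in \<mu>. norm (cinner (s (W (U t h)) l) (s (W (U t g)) l) * b l)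
        \<le> norm (Bb * norm (cinner (s (W (U t h)) l) (s (W (U t g)) l)))"
      using Bb by (intro AE_I2) (simp add: norm_mult abs_mult mult.commute[of Bb] mult_left_mono)
  qed
  obtain Q where Q: "0 \<le> Q" "\<And>t l. l \<in> K \<Longrightarrow> norm (shadow v t (s0 h) l) \<le> Q"
    "\<And>t l. l \<in> K \<Longrightarrow> norm (shadow v t (s0 g) l) \<le> Q"
  proof -
    have "\<exists>q. \<forall>t. \<forall>l\<in>K. norm (shadow v t (s0 h) l) \<le> q" if "h \<in> D0" for h
    proof -
      have cn: "continuous_on \<Lambda>0 (\<lambda>l. norm (x l))" if "x \<in> \<Gamma>0" for x
        using field0 that by (simp add: continuous_field_def)
      have "continuous_on K (\<lambda>l. norm (C l (v l)) * norm (s0 h l))"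
        by (intro continuous_on_mult continuous_on_subset[OF cn K\<Lambda>] C_section v s0_section that)
      then have "bounded ((\<lambda>l. norm (C l (v l)) * norm (s0 h l)) ` K)"
        by (intro compact_imp_bounded compact_continuous_image K)
      then obtain q where q: "\<And>l. l \<in> K \<Longrightarrow> norm (norm (C l (v l)) * norm (s0 h l)) \<le> q"
        unfolding bounded_iff by blast
      have "norm (shadow v t (s0 h) l) \<le> q" if "l \<in> K" for t l
      proof -
        have l: "l \<in> \<Lambda>0" using that K\<Lambda> by auto
        have "norm (shadow v t (s0 h) l) \<le> norm (C l (v l)) * norm (Ufib t l (s0 h l))"
          unfolding shadow_def by (rule norm_cinner_le)
        also have "norm (Ufib t l (s0 h l)) = norm (s0 h l)"
          by (rule unitary_between_simps(5)[OF Ufib_unitary[OF l] s0_fibre[OF \<open>h \<in> D0\<close> l]])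
        also have "norm (C l (v l)) * norm (s0 h l) \<le> q"
          using q[OF that] by simp
        finally show ?thesis .
      qed
      then show ?thesis by blast
    qed
    then obtain q where q: "\<And>h t l. h \<in> D0 \<Longrightarrow> l \<in> K \<Longrightarrow> norm (shadow v t (s0 h) l) \<le> q h" by metis
    show ?thesis
    proof (rule that[of "max 0 (max (q h) (q g))"])
      show "norm (shadow v t (s0 h) l) \<le> max 0 (max (q h) (q g))" if "l \<in> K" for t l
        using q[OF h(1) that, of t] by linarith
      show "norm (shadow v t (s0 g) l) \<le> max 0 (max (q h) (q g))" if "l \<in> K" for t l
        using q[OF h(2) that, of t] by linarith
    qed simp
  qed
  define M where "M = (2 * Q + 1) * Ba * measure \<mu> K"
  have M0: "0 \<le> M" using Q Ba by (simp add: M_def)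
  have diff: "((\<lambda>t. (LINT l|\<mu>. cnj (shadow v t (s0 h) l) * shadow v t (s0 g) l * a l)
      - (LINT l|\<mu>. cinner (s (W (U t h)) l) (s (W (U t g)) l) * b l)) \<longlongrightarrow> 0) at_top"
  proof (rule tendstoI)
    fix e :: real assume e: "e > 0"
    \<comment> \<open>\<open>M + 1\<close> avoids a division by zero; \<open>d \<le> 1\<close> is what the product estimate asks for.\<close>
    define d where "d = min 1 (e / (M + 1))"
    have d: "0 < d" "d \<le> 1" using e M0 by (auto simp: d_def)
    have "d * M \<le> e / (M + 1) * M" using M0 by (intro mult_right_mono) (auto simp: d_def)
    also have "\<dots> < e" using e M0 by (simp add: divide_simps)
    finally have dM: "d * M < e" .
    have "\<forall>\<^sub>F t in at_top. W (U t h) \<in> D \<and> W (U t g) \<in> D \<and>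
       (\<forall>l\<in>K. norm (cinner (C l (v l)) (s0 (U t h) l) - cinner (v l) (s (W (U t h)) l)) < d) \<and>
       (\<forall>l\<in>K. norm (cinner (C l (v l)) (s0 (U t g) l) - cinner (v l) (s (W (U t g)) l)) < d)"
      by (intro eventually_conj eventually_W_U h uniform_comparison v K K\<Lambda> d)
    then show "\<forall>\<^sub>F t in at_top. dist ((LINT l|\<mu>. cnj (shadow v t (s0 h) l) * shadow v t (s0 g) l * a l)
      - (LINT l|\<mu>. cinner (s (W (U t h)) l) (s (W (U t g)) l) * b l)) 0 < e"
    proof eventually_elim
      case (elim t)
      then have WD: "W (U t h) \<in> D" "W (U t g) \<in> D" by auto
      let ?q = "\<lambda>l. cnj (shadow v t (s0 h) l) * shadow v t (s0 g) l * a l"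
      let ?p = "\<lambda>l. cnj (p h t l) * p g t l * a l"
      have bound: "norm (?q l - ?p l) \<le> d * (2 * Q + 1) * Ba * indicator K l" for l
      proof (cases "l \<in> K")
        case True
        have "norm (shadow v t (s0 h) l - p h t l) \<le> d" "norm (shadow v t (s0 g) l - p g t l) \<le> d"
          using elim True shadow_eq[OF True] h by (auto simp: p_def less_imp_le)
        then have "norm (cnj (shadow v t (s0 h) l) * shadow v t (s0 g) l - cnj (p h t l) * p g t l)
            \<le> d * (2 * Q + 1)"
          by (intro norm_cnj_mult_diff_le Q True d)
        then have "norm ((cnj (shadow v t (s0 h) l) * shadow v t (s0 g) l - cnj (p h t l) * p g t l) * a l)
            \<le> d * (2 * Q + 1) * Ba"
          unfolding norm_mult using d Q(1) Ba by (intro mult_mono) auto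
        then show ?thesis using True by (simp add: left_diff_distrib)
      qed (use a in \<open>simp add: cc_on_def\<close>)
      have iK: "integrable \<mu> (\<lambda>l. d * (2 * Q + 1) * Ba * indicator K l :: real)"
        using finK K_meas by (intro integrable_mult_right integrable_real_indicator)
      have "(LINT l|\<mu>. ?q l) - (LINT l|\<mu>. ?p l) = (LINT l|\<mu>. ?q l - ?p l)"
        by (rule Bochner_Integration.integral_diff[OF shadow_int p_int[OF WD], symmetric])
      also have "norm \<dots> \<le> (LINT l|\<mu>. norm (?q l - ?p l))"
        by (rule integral_norm_bound)
      also have "\<dots> \<le> (LINT l|\<mu>. d * (2 * Q + 1) * Ba * indicator K l)"
        by (intro integral_mono iK bound integrable_norm Bochner_Integration.integrable_diff shadow_int p_int[OF WD])
      also have "\<dots> = d * M"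
        using K_meas finK by (simp add: M_def)
      also note dM
      finally show ?case
        unfolding p_a[OF WD] by (simp add: dist_norm)
    qed
  qed
  have "((\<lambda>t. LINT l|\<mu>. cinner (s (W (U t h)) l) (s (W (U t g)) l) * b l)
    \<longlongrightarrow> (LINT l|\<mu>0. cinner (s0 h l) (s0 g l) * b l)) at_top"
    using cc_on_C0[OF K(1)] b h by (intro vector_state_limit) auto
  from tendsto_add[OF diff this] show ?thesis
    by (simp add: b_def mult_ac)
qed

section \<open>The asymptotic identity for the generated module\<close>

lemma module_fibre:
  assumes "x \<in> section_module (s0 ` D0) N" "l \<in> \<Lambda>0"
  shows "x l \<in> F0 l"
  using assms(1)
  by (rule section_module_in_fibre) (auto simp: s0_fibre fibre0_subspace assms(2))

lemma shadow_add:
  assumes "x \<in> section_module (s0 ` D0) N" "y \<in> section_module (s0 ` D0) N" "l \<in> \<Lambda>0"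
  shows "shadow v t (\<lambda>l. x l + y l) l = shadow v t x l + shadow v t y l"
  unfolding shadow_def
  using unitary_between_simps(2)[OF Ufib_unitary[OF assms(3)] module_fibre module_fibre] assms
  by (simp add: cinner_add_right)

lemma shadow_scale:
  assumes "h \<in> D0" "l \<in> \<Lambda>0"
  shows "shadow v t (\<lambda>l. c l *\<^sub>C s0 h l) l = c l * shadow v t (s0 h) l"
  unfolding shadow_def
  using unitary_between_simps(3)[OF Ufib_unitary[OF assms(2)] s0_fibre] assms
  by (simp add: cinner_scaleC_right)

lemma shadow_continuous:
  assumes x: "x \<in> section_module (s0 ` D0) N" and N: "N \<subseteq> \<Lambda>0" and v: "v \<in> \<Gamma>"
  shows "continuous_on N (shadow v t x)"
  using x
proof induction
  case (generator x c)
  then obtain h where h: "h \<in> D0" "x = s0 h" by auto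
  have "continuous_on N (\<lambda>l. cinner (C l (v l)) (s0 (U t h) l))"
    using h N
    by (intro continuous_on_subset[OF continuous_field_cinner[OF field0 C_section[OF v] s0_section[OF U_invariant]]])
  then have "continuous_on N (\<lambda>l. c l * cinner (C l (v l)) (s0 (U t h) l))"
    by (intro continuous_on_mult generator)
  moreover have "shadow v t (\<lambda>l. c l *\<^sub>C x l) l = c l * cinner (C l (v l)) (s0 (U t h) l)"
    if "l \<in> N" for l
    using that N h shadow_scale[of h l v t c] by (auto simp: shadow_def s0_U)
  ultimately show ?case by (simp cong: continuous_on_cong)
next
  case (add x y)
  then have "continuous_on N (\<lambda>l. shadow v t x l + shadow v t y l)"
    by (intro continuous_on_add)
  moreover have "shadow v t (\<lambda>l. x l + y l) l = shadow v t x l + shadow v t y l" if "l \<in> N" for l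
    using that N by (intro shadow_add[OF add(1,2)]) auto
  ultimately show ?case by (simp cong: continuous_on_cong)
qed

lemma module_cinner_continuous:
  assumes "x \<in> section_module (s0 ` D0) N" "y \<in> section_module (s0 ` D0) N" "N \<subseteq> \<Lambda>0"
  shows "continuous_on N (\<lambda>l. cinner (x l) (y l))"
proof (rule section_module_continuous_cinner[OF _ assms(1,2)])
  fix x y assume "x \<in> s0 ` D0" "y \<in> s0 ` D0"
  then have "x \<in> \<Gamma>0" "y \<in> \<Gamma>0" using s0_section by auto
  then show "continuous_on N (\<lambda>l. cinner (x l) (y l))"
    by (rule continuous_on_subset[OF continuous_field_cinner[OF field0] assms(3)])
qed

lemma section_norm_continuous: "v \<in> \<Gamma> \<Longrightarrow> continuous_on N (\<lambda>l. norm (v l))"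
  using field continuous_on_subset unfolding continuous_field_def by blast

lemma C_section_norm_continuous: "v \<in> \<Gamma> \<Longrightarrow> N \<subseteq> \<Lambda>0 \<Longrightarrow> continuous_on N (\<lambda>l. norm (C l (v l)))"
  using continuous_on_norm_of_cinner[OF
      continuous_on_subset[OF continuous_field_cinner[OF field0 C_section C_section]]] .

lemma module_integrable:
  assumes N: "open N" "N \<subseteq> \<Lambda>0" and v: "v \<in> \<Gamma>" and fin: "emeasure \<mu>0 N < \<infinity>" "emeasure \<mu> N < \<infinity>"
    and K: "compact K" "K \<subseteq> N"
    and x: "x \<in> section_module (s0 ` D0) N" and y: "y \<in> section_module (s0 ` D0) N"
    and a: "a \<in> cc_on K"
  shows "integrable \<mu> (\<lambda>l. cnj (shadow v t x l) * shadow v t y l * a l)"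
    and "integrable \<mu>0 (\<lambda>l. complex_of_real ((norm (v l))\<^sup>2) * cinner (x l) (y l) * a l)"
proof -
  have K\<Lambda>: "K \<subseteq> \<Lambda>0" using N K by auto
  have N_sets: "N \<in> sets \<mu>0" "N \<in> sets \<mu>"
    using N by (auto simp: sets_\<mu>0 sets_\<mu> sets_restrict_space intro!: image_eqI[of _ _ N])
  have finK: "emeasure \<mu>0 K < \<infinity>" "emeasure \<mu> K < \<infinity>"
    using le_less_trans[OF emeasure_mono[OF K(2) N_sets(1)] fin(1)]
      le_less_trans[OF emeasure_mono[OF K(2) N_sets(2)] fin(2)] by auto
  show "integrable \<mu> (\<lambda>l. cnj (shadow v t x l) * shadow v t y l * a l)"
  proof (rule cc_on_integrable[OF _ K(1) subset_UNIV sets_\<mu> finK(2)], rule cc_on_mult[OF a K N(1)])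
    show "continuous_on N (\<lambda>l. cnj (shadow v t x l) * shadow v t y l)"
      by (intro continuous_on_mult continuous_on_cnj shadow_continuous x y N v)
  qed
  show "integrable \<mu>0 (\<lambda>l. complex_of_real ((norm (v l))\<^sup>2) * cinner (x l) (y l) * a l)"
  proof (rule cc_on_integrable[OF _ K(1) K\<Lambda> sets_\<mu>0 finK(1)], rule cc_on_mult[OF a K N(1)])
    show "continuous_on N (\<lambda>l. complex_of_real ((norm (v l))\<^sup>2) * cinner (x l) (y l))"
      by (intro continuous_on_mult continuous_on_of_real continuous_on_power
          section_norm_continuous module_cinner_continuous x y N v)
  qed
qed

text \<open>
  Coefficient functions of generators are absorbed into the test function, which is why the
  induction runs with the test function on \<open>K\<close> left arbitrary.  Additivity in
  each argument does the rest.
\<close>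

lemma module_limit:
  assumes N: "open N" "N \<subseteq> \<Lambda>0" and v: "v \<in> \<Gamma>" "\<And>l. l \<in> N \<Longrightarrow> v l \<noteq> 0"
    and fin: "emeasure \<mu>0 N < \<infinity>" "emeasure \<mu> N < \<infinity>"
    and K: "compact K" "K \<subseteq> N"
    and x: "x \<in> section_module (s0 ` D0) N" and y: "y \<in> section_module (s0 ` D0) N"
    and a: "a \<in> cc_on K"
  shows "((\<lambda>t. LINT l|\<mu>. cnj (shadow v t x l) * shadow v t y l * a l)
    \<longlongrightarrow> (LINT l|\<mu>0. complex_of_real ((norm (v l))\<^sup>2) * cinner (x l) (y l) * a l)) at_top"
proof -
  let ?M = "section_module (s0 ` D0) N"
  have K\<Lambda>: "K \<subseteq> \<Lambda>0" using N K by auto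
  note int = module_integrable(1)[OF N v(1) fin K] and int0 = module_integrable(2)[OF N v(1) fin K]
  let ?L = "\<lambda>x y. \<forall>a\<in>cc_on K. ((\<lambda>t. LINT l|\<mu>. cnj (shadow v t x l) * shadow v t y l * a l)
    \<longlongrightarrow> (LINT l|\<mu>0. complex_of_real ((norm (v l))\<^sup>2) * cinner (x l) (y l) * a l)) at_top"
  have gen: "?L (\<lambda>l. c l *\<^sub>C s0 h l) (\<lambda>l. d l *\<^sub>C s0 g l)"
    if h: "h \<in> D0" "g \<in> D0" and c: "continuous_on N c" "continuous_on N d" for h g c d
  proof
    fix a assume a: "a \<in> cc_on K"
    have "(\<lambda>l. (cnj (c l) * d l) * a l) \<in> cc_on K"
      by (rule cc_on_mult[OF a K N(1)]) (intro continuous_on_mult continuous_on_cnj c)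
    from generator_limit[OF N v fin(2) K this h]
    have lim: "((\<lambda>t. LINT l|\<mu>. cnj (shadow v t (s0 h) l) * shadow v t (s0 g) l * (cnj (c l) * d l * a l))
      \<longlongrightarrow> (LINT l|\<mu>0. complex_of_real ((norm (v l))\<^sup>2) * cinner (s0 h l) (s0 g l) * (cnj (c l) * d l * a l))) at_top" .
    have left: "cnj (shadow v t (s0 h) l) * shadow v t (s0 g) l * (cnj (c l) * d l * a l)
       = cnj (shadow v t (\<lambda>l. c l *\<^sub>C s0 h l) l) * shadow v t (\<lambda>l. d l *\<^sub>C s0 g l) l * a l" for t l
    proof (cases "l \<in> K")
      case True
      then have l: "l \<in> \<Lambda>0" using K\<Lambda> by auto
      show ?thesis by (simp add: shadow_scale[OF h(1) l] shadow_scale[OF h(2) l])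
    qed (use a in \<open>simp add: cc_on_def\<close>)
    have right: "complex_of_real ((norm (v l))\<^sup>2) * cinner (s0 h l) (s0 g l) * (cnj (c l) * d l * a l)
      = complex_of_real ((norm (v l))\<^sup>2) * cinner (c l *\<^sub>C s0 h l) (d l *\<^sub>C s0 g l) * a l" for l
      by (simp add: cinner_scaleC_left cinner_scaleC_right)
    show "((\<lambda>t. LINT l|\<mu>. cnj (shadow v t (\<lambda>l. c l *\<^sub>C s0 h l) l) * shadow v t (\<lambda>l. d l *\<^sub>C s0 g l) l * a l)
      \<longlongrightarrow> (LINT l|\<mu>0. complex_of_real ((norm (v l))\<^sup>2) * cinner (c l *\<^sub>C s0 h l) (d l *\<^sub>C s0 g l) * a l)) at_top"
      using lim unfolding left right .
  qed
  have split: "cnj (shadow v t x l) * shadow v t (\<lambda>l. y l + z l) l * a l =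
      cnj (shadow v t x l) * shadow v t y l * a l + cnj (shadow v t x l) * shadow v t z l * a l"
      "cnj (shadow v t (\<lambda>l. y l + z l) l) * shadow v t x l * a l =
      cnj (shadow v t y l) * shadow v t x l * a l + cnj (shadow v t z l) * shadow v t x l * a l"
    if "y \<in> ?M" "z \<in> ?M" "a \<in> cc_on K" for t x y z a l
  proof -
    have "l \<in> K \<Longrightarrow> l \<in> \<Lambda>0" using K\<Lambda> by auto
    then show "cnj (shadow v t x l) * shadow v t (\<lambda>l. y l + z l) l * a l =
      cnj (shadow v t x l) * shadow v t y l * a l + cnj (shadow v t x l) * shadow v t z l * a l"
      "cnj (shadow v t (\<lambda>l. y l + z l) l) * shadow v t x l * a l =
      cnj (shadow v t y l) * shadow v t x l * a l + cnj (shadow v t z l) * shadow v t x l * a l"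
      using that shadow_add[OF that(1,2), of l v t] by (cases "l \<in> K"; auto simp: cc_on_def algebra_simps)+
  qed
  have add_right: "?L x (\<lambda>l. y l + z l)" if M: "x \<in> ?M" "y \<in> ?M" "z \<in> ?M" and L: "?L x y" "?L x z" for x y z
  proof
    fix a assume a: "a \<in> cc_on K"
    have "((\<lambda>t. (LINT l|\<mu>. cnj (shadow v t x l) * shadow v t y l * a l) +
        (LINT l|\<mu>. cnj (shadow v t x l) * shadow v t z l * a l))
      \<longlongrightarrow> (LINT l|\<mu>0. complex_of_real ((norm (v l))\<^sup>2) * cinner (x l) (y l) * a l) +
        (LINT l|\<mu>0. complex_of_real ((norm (v l))\<^sup>2) * cinner (x l) (z l) * a l)) at_top"
      using L a by (intro tendsto_add) auto
    then show "((\<lambda>t. LINT l|\<mu>. cnj (shadow v t x l) * shadow v t (\<lambda>l. y l + z l) l * a l)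
      \<longlongrightarrow> (LINT l|\<mu>0. complex_of_real ((norm (v l))\<^sup>2) * cinner (x l) (y l + z l) * a l)) at_top"
      unfolding split(1)[OF M(2,3) a] cinner_add_right distrib_left distrib_right
      by (simp only: Bochner_Integration.integral_add[OF int[OF M(1,2) a] int[OF M(1,3) a]]
          Bochner_Integration.integral_add[OF int0[OF M(1,2) a] int0[OF M(1,3) a]])
  qed
  have add_left: "?L (\<lambda>l. y l + z l) x" if M: "x \<in> ?M" "y \<in> ?M" "z \<in> ?M" and L: "?L y x" "?L z x" for x y z
  proof
    fix a assume a: "a \<in> cc_on K"
    have "((\<lambda>t. (LINT l|\<mu>. cnj (shadow v t y l) * shadow v t x l * a l) +
        (LINT l|\<mu>. cnj (shadow v t z l) * shadow v t x l * a l))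
      \<longlongrightarrow> (LINT l|\<mu>0. complex_of_real ((norm (v l))\<^sup>2) * cinner (y l) (x l) * a l) +
        (LINT l|\<mu>0. complex_of_real ((norm (v l))\<^sup>2) * cinner (z l) (x l) * a l)) at_top"
      using L a by (intro tendsto_add) auto
    then show "((\<lambda>t. LINT l|\<mu>. cnj (shadow v t (\<lambda>l. y l + z l) l) * shadow v t x l * a l)
      \<longlongrightarrow> (LINT l|\<mu>0. complex_of_real ((norm (v l))\<^sup>2) * cinner (y l + z l) (x l) * a l)) at_top"
      unfolding split(2)[OF M(2,3) a] cinner_add_left distrib_left distrib_right
      by (simp only: Bochner_Integration.integral_add[OF int[OF M(2,1) a] int[OF M(3,1) a]]
          Bochner_Integration.integral_add[OF int0[OF M(2,1) a] int0[OF M(3,1) a]])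
  qed
  have "?L x y"
    using x
  proof induction
    case (generator x c)
    then obtain h where h: "h \<in> D0" "x = s0 h" by auto
    have xc: "(\<lambda>l. c l *\<^sub>C x l) \<in> ?M" by (intro section_module.generator generator)
    from y show ?case
    proof induction
      case (generator z d)
      then obtain g where "g \<in> D0" "z = s0 g" by auto
      then show ?case using gen[OF h(1)] h \<open>continuous_on N c\<close> generator by blast
    next
      case (add z z')
      then show ?case by (intro add_right xc)
    qed
  next
    case (add z z')
    then show ?case by (intro add_left y)
  qed
  then show ?thesis using a by blast
qed

section \<open>Local density of the measures\<close>

lemma exists_local_section:
  obtains v N where "v \<in> \<Gamma>" "open N" "l \<in> N" "\<And>z. z \<in> N \<Longrightarrow> v z \<noteq> 0"
proof -
  obtain b where b: "b \<in> F l" "b \<noteq> 0"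
    using one_dimensional_span[OF dim_one fibre_subspace] by metis
  have "\<exists>v\<in>\<Gamma>. v l \<noteq> 0"
  proof (rule ccontr)
    assume "\<not> (\<exists>v\<in>\<Gamma>. v l \<noteq> 0)"
    then have "(\<lambda>x. x l) ` \<Gamma> \<subseteq> {0}" by auto
    then have "closure ((\<lambda>x. x l) ` \<Gamma>) \<subseteq> {0}" by (metis closure_minimal closed_singleton)
    moreover have "F l \<subseteq> closure ((\<lambda>x. x l) ` \<Gamma>)"
      using field by (simp add: continuous_field_def)
    ultimately show False using b by auto
  qed
  then obtain v where v: "v \<in> \<Gamma>" "v l \<noteq> 0" by auto
  have "open (UNIV \<inter> (\<lambda>z. norm (v z)) -` (- {0}))"
    by (intro continuous_open_preimage section_norm_continuous v) auto
  then show ?thesis using that[OF v(1), of "(\<lambda>z. norm (v z)) -` (- {0})"] v by auto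
qed

text \<open>
  Parseval for the rotated frame \<open>U\<^sub>t e\<^sub>i\<close>.  The right side does not depend on \<open>t\<close>, and this is what turns
  the asymptotic identity into an exact one.
\<close>

lemma frame_sum:
  assumes N: "N \<subseteq> \<Lambda>0" "z \<in> N" and e: "\<And>i. i < n \<Longrightarrow> e i \<in> section_module (s0 ` D0) N"
    and on: "orthonormal_family n (\<lambda>i. e i z)" and dim: "complex_vector.dim (F0 z) = n"
    and v: "v \<in> \<Gamma>"
  shows "(\<Sum>i<n. cnj (shadow v t (e i) z) * shadow v t (e i) z)
    = complex_of_real ((norm (C z (v z)))\<^sup>2)"
proof -
  have z: "z \<in> \<Lambda>0" using N by auto
  have eF: "e i z \<in> F0 z" if "i < n" for i using module_fibre[OF e[OF that] z] .
  note u = Ufib_unitary[OF z]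
  have "orthonormal_family n (\<lambda>i. Ufib t z (e i z))"
    using on unitary_between_simps(4)[OF u eF eF] by (simp add: orthonormal_family_def)
  then show ?thesis
    unfolding shadow_def dim[symmetric]
    using eF unitary_between_simps(1)[OF u]
    by (intro parseval fibre0_subspace finite0 z C_fibre section_fibre v) (auto simp: dim)
qed

lemma exists_frame:
  assumes l: "l \<in> \<Lambda>0" and n: "n = complex_vector.dim (F0 l)"
  obtains N e where "open N" "l \<in> N" "N \<subseteq> \<Lambda>0" "\<And>i. i < n \<Longrightarrow> e i \<in> section_module (s0 ` D0) N"
    "\<And>z. z \<in> N \<Longrightarrow> orthonormal_family n (\<lambda>i. e i z)" "\<And>z. z \<in> N \<Longrightarrow> complex_vector.dim (F0 z) = n"
proof -
  obtain V \<phi> where V: "openin (top_of_set \<Lambda>0) V" "l \<in> V" "\<And>z. z \<in> V \<Longrightarrow> unitary_between (F0 z) (F0 l) (\<phi> z)"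
    using trivial0 l unfolding locally_trivial_def by metis
  have "\<exists>N e. open N \<and> l \<in> N \<and> N \<subseteq> \<Lambda>0 \<and> (\<forall>i<n. e i \<in> section_module (s0 ` D0) N) \<and>
    (\<forall>z\<in>N. orthonormal_family n (\<lambda>i. e i z))"
  proof (rule exists_local_orthonormal_frame[OF open_base l])
    show "n \<le> complex_vector.dim (F0 l)" by (simp add: n)
    show "F0 l \<subseteq> (\<lambda>x. x l) ` s0 ` D0" using fibre0_image[OF l] by auto
    show "x z \<in> F0 z" if "x \<in> s0 ` D0" "z \<in> \<Lambda>0" for x z using that s0_fibre by auto
    show "continuous_on \<Lambda>0 (\<lambda>z. cinner (x z) (y z))" if "x \<in> s0 ` D0" "y \<in> s0 ` D0" for x y
      using that by (intro continuous_field_cinner[OF field0]) (auto simp: s0_section)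
  qed (rule fibre0_subspace)
  then obtain N e where N: "open N" "l \<in> N" "N \<subseteq> \<Lambda>0" "\<And>i. i < n \<Longrightarrow> e i \<in> section_module (s0 ` D0) N"
    "\<And>z. z \<in> N \<Longrightarrow> orthonormal_family n (\<lambda>i. e i z)" by metis
  show ?thesis
  proof (rule that[of "N \<inter> V" e])
    show "open (N \<inter> V)" using N(1) V(1) open_base by (metis open_Int openin_open_eq)
    show "l \<in> N \<inter> V" "N \<inter> V \<subseteq> \<Lambda>0" using N V by auto
    show "e i \<in> section_module (s0 ` D0) (N \<inter> V)" if "i < n" for i
      by (rule section_module_mono[OF N(4)[OF that]]) auto
    show "orthonormal_family n (\<lambda>i. e i z)" if "z \<in> N \<inter> V" for z using N(5) that by auto
    show "complex_vector.dim (F0 z) = n" if z: "z \<in> N \<inter> V" for z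
    proof -
      have "z \<in> N" "z \<in> V" "z \<in> \<Lambda>0" using z N by auto
      then show ?thesis
        unfolding n using N(5) module_fibre[OF N(4)]
        by (intro dim_unitary_between[OF V(3)] fibre0_subspace finite0 l) (auto simp: n)
    qed
  qed
qed

text \<open>
  If all sections \<open>s h\<close> vanished at \<open>l\<close>, then every \<open>\<langle>C v, U\<^sub>t e\<^sub>i\<rangle>\<close> would tend to \<open>0\<close> at \<open>l\<close>, while the
  sum of their squared moduli is the positive constant \<open>|C v|\<^sup>2\<close>.
\<close>

lemma exists_nonvanishing_asymptotic_section:
  assumes l: "l \<in> \<Lambda>0"
  shows "\<exists>h\<in>D. s h l \<noteq> 0"
proof (rule ccontr)
  assume "\<not> (\<exists>h\<in>D. s h l \<noteq> 0)"
  then have s0: "s h l = 0" if "h \<in> D" for h using that by auto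
  obtain v where v: "v \<in> \<Gamma>" "v l \<noteq> 0" using exists_local_section by metis
  let ?n = "complex_vector.dim (F0 l)"
  obtain N e where N: "l \<in> N" "N \<subseteq> \<Lambda>0" "\<And>i. i < ?n \<Longrightarrow> e i \<in> section_module (s0 ` D0) N"
     "\<And>z. z \<in> N \<Longrightarrow> orthonormal_family ?n (\<lambda>i. e i z)"
    using exists_frame[OF l refl] by metis
  have "((\<lambda>t. shadow v t (e i) l) \<longlongrightarrow> 0) at_top" if i: "i < ?n" for i
  proof -
    obtain h where h: "h \<in> D0" "e i l = s0 h l"
      using module_fibre[OF N(3)[OF i] l] fibre0_image[OF l] by auto
    show ?thesis
    proof (rule tendstoI)
      fix d :: real assume "d > 0"
      have "\<forall>\<^sub>F t in at_top. \<forall>z\<in>{l}.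
          norm (cinner (C z (v z)) (s0 (U t h) z) - cinner (v z) (s (W (U t h)) z)) < d"
        using l by (intro uniform_comparison h v \<open>d > 0\<close>) auto
      then show "\<forall>\<^sub>F t in at_top. dist (shadow v t (e i) l) 0 < d"
        using eventually_W_U[OF h(1)]
        by eventually_elim (simp add: s0 shadow_def h s0_U l)
    qed
  qed
  then have "((\<lambda>t. \<Sum>i<?n. cnj (shadow v t (e i) l) * shadow v t (e i) l) \<longlongrightarrow> (\<Sum>i<?n. cnj 0 * 0)) at_top"
    by (intro tendsto_sum tendsto_mult tendsto_cnj) auto
  then have "((\<lambda>t::real. complex_of_real ((norm (C l (v l)))\<^sup>2)) \<longlongrightarrow> 0) at_top"
    using frame_sum[OF N(2,1) N(3) N(4)[OF N(1)] refl v(1)] by simp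
  then have "complex_of_real ((norm (C l (v l)))\<^sup>2) = 0"
    by (simp add: tendsto_const_iff del: of_real_power)
  then show False using C_nonzero[OF l section_fibre[OF v(1)] v(2)] by simp
qed

text \<open>
  Any nonzero vector of the line computes the trace, so a local section without zeros exhibits the
  density as a continuous function.
\<close>

lemma dim_over_trace_eq:
  assumes "l \<in> \<Lambda>0" "v \<in> F l" "v \<noteq> 0"
  shows "dim_over_trace F0 F C l = real (complex_vector.dim (F0 l)) * (norm v)\<^sup>2 / (norm (C l v))\<^sup>2"
  unfolding dim_over_trace_def
  by (simp only: trace_adjoint_one_dimensional[OF dim_one fibre_subspace C_linear[OF assms(1)] assms(2,3)])
    (simp add: C_nonzero[OF assms] del: of_real_power of_real_divide)

lemma dim_over_trace_nonneg: "l \<in> \<Lambda>0 \<Longrightarrow> 0 \<le> dim_over_trace F0 F C l"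
  using one_dimensional_span[OF dim_one fibre_subspace, of l] dim_over_trace_eq[of l]
  by (metis divide_nonneg_nonneg mult_nonneg_nonneg of_nat_0_le_iff zero_le_power2)

text \<open>
  On \<open>N\<close> there are a section \<open>v\<close> without zeros, an orthonormal frame, and sections of square
  integrable norm bounded away from \<open>0\<close>.  Sum \<open>module_limit\<close> over the frame, with test function
  \<open>a / |C v|\<^sup>2\<close>.
\<close>

lemma local_density:
  assumes l: "l \<in> \<Lambda>0"
  obtains N where "open N" "l \<in> N" "N \<subseteq> \<Lambda>0" "emeasure \<mu>0 N < \<infinity>" "emeasure \<mu> N < \<infinity>"
    "continuous_on N (dim_over_trace F0 F C)"
    "\<forall>K a. compact K \<longrightarrow> K \<subseteq> N \<longrightarrow> a \<in> cc_on K \<longrightarrow>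
      (LINT z|\<mu>0. complex_of_real (dim_over_trace F0 F C z) * a z) = (LINT z|\<mu>. a z)"
proof -
  define n where "n = complex_vector.dim (F0 l)"
  obtain v N1 where v: "v \<in> \<Gamma>" and N1: "open N1" "l \<in> N1" "\<And>z. z \<in> N1 \<Longrightarrow> v z \<noteq> 0"
    using exists_local_section by metis
  obtain N2 e where N2: "open N2" "l \<in> N2" "N2 \<subseteq> \<Lambda>0"
    and e: "\<And>i. i < n \<Longrightarrow> e i \<in> section_module (s0 ` D0) N2"
    "\<And>z. z \<in> N2 \<Longrightarrow> orthonormal_family n (\<lambda>i. e i z)"
    and dim: "\<And>z. z \<in> N2 \<Longrightarrow> complex_vector.dim (F0 z) = n"
    using exists_frame[OF l n_def] by metis
  \<comment> \<open>This nonzero vector is the value at \<open>l\<close> of some section \<open>s0 h0\<close>, which makes \<open>\<mu>0\<close> finite nearby.\<close>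
  have "C l (v l) \<in> F0 l" by (rule C_fibre[OF l section_fibre[OF v]])
  then obtain h0 where h0: "h0 \<in> D0" "s0 h0 l \<noteq> 0"
    using fibre0_image[OF l] C_nonzero[OF l section_fibre[OF v] N1(3)[OF N1(2)]] by auto
  obtain N3 where N3: "open N3" "l \<in> N3" "N3 \<subseteq> \<Lambda>0" "emeasure \<mu>0 N3 < \<infinity>"
    using spectral_decomposition_finite_nhd[OF field0 spectral0 open_base l h0] by metis
  obtain h where h: "h \<in> D" "s h l \<noteq> 0" using exists_nonvanishing_asymptotic_section[OF l] by auto
  obtain N4 where N4: "open N4" "l \<in> N4" "emeasure \<mu> N4 < \<infinity>"
    using spectral_decomposition_finite_nhd[OF field spectral open_UNIV UNIV_I h] by metis
  \<comment> \<open>\<open>N1\<close>: \<open>v\<close> has no zeros; \<open>N2\<close>: the frame; \<open>N3\<close>, \<open>N4\<close>: \<open>\<mu>0\<close> and \<open>\<mu>\<close> are finite.\<close>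
  define N where "N = N1 \<inter> N2 \<inter> N3 \<inter> N4"
  have N: "open N" "l \<in> N" "N \<subseteq> \<Lambda>0" "N \<subseteq> N2"
    using N1 N2 N3 N4 by (auto simp: N_def)
  have v0: "v z \<noteq> 0" if "z \<in> N" for z using that N1 by (auto simp: N_def)
  have fin0: "emeasure \<mu>0 N < \<infinity>"
  proof (rule le_less_trans[OF emeasure_mono N3(4)])
    show "N3 \<in> sets \<mu>0" using N3 by (auto simp: sets_\<mu>0 sets_restrict_space intro!: image_eqI[of _ _ N3])
  qed (auto simp: N_def)
  have fin: "emeasure \<mu> N < \<infinity>"
  proof (rule le_less_trans[OF emeasure_mono N4(3)])
    show "N4 \<in> sets \<mu>" using N4 by (simp add: sets_\<mu>)
  qed (auto simp: N_def)
  have Cv0: "C z (v z) \<noteq> 0" if "z \<in> N" for z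
    using that N(3) by (intro C_nonzero section_fibre v v0) auto
  have dot: "dim_over_trace F0 F C z = real n * (norm (v z))\<^sup>2 / (norm (C z (v z)))\<^sup>2" if "z \<in> N" for z
    using dim_over_trace_eq[OF _ section_fibre[OF v] v0[OF that]] dim[of z] that N by auto
  have eN: "e i \<in> section_module (s0 ` D0) N" if "i < n" for i
    by (rule section_module_mono[OF e(1)[OF that] N(4)])
  show ?thesis
  proof (rule that[OF N(1,2,3) fin0 fin], goal_cases)
    case 1
    have "continuous_on N (\<lambda>z. real n * (norm (v z))\<^sup>2 / (norm (C z (v z)))\<^sup>2)"
      using Cv0
      by (intro continuous_on_divide continuous_on_mult continuous_on_const continuous_on_power
          section_norm_continuous C_section_norm_continuous v N) auto
    then show ?case using dot by (simp cong: continuous_on_cong)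
  next
    case 2
    show ?case
    proof (intro allI impI)
      fix K a assume K: "compact K" "K \<subseteq> N" and a: "a \<in> cc_on K"
      \<comment> \<open>Dividing by \<open>|C v|\<^sup>2\<close> cancels the factor that the frame sum produces on the side of \<open>\<mu>\<close>.\<close>
      define a' where "a' z = complex_of_real (1 / (norm (C z (v z)))\<^sup>2) * a z" for z
      have a': "a' \<in> cc_on K"
        unfolding a'_def using Cv0
        by (intro cc_on_mult[OF a K N(1)] continuous_on_of_real continuous_on_divide continuous_on_const
            continuous_on_power C_section_norm_continuous v N) auto
      note int = module_integrable[OF N(1,3) v fin0 fin K eN eN a']
      have "((\<lambda>t. \<Sum>i<n. LINT z|\<mu>. cnj (shadow v t (e i) z) * shadow v t (e i) z * a' z)
        \<longlongrightarrow> (\<Sum>i<n. LINT z|\<mu>0. complex_of_real ((norm (v z))\<^sup>2) * cinner (e i z) (e i z) * a' z)) at_top"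
        using eN by (intro tendsto_sum module_limit[OF N(1,3) v v0 fin0 fin K _ _ a']) auto
      moreover have "(\<Sum>i<n. LINT z|\<mu>. cnj (shadow v t (e i) z) * shadow v t (e i) z * a' z) = (LINT z|\<mu>. a z)" for t
      proof -
        have "(\<Sum>i<n. LINT z|\<mu>. cnj (shadow v t (e i) z) * shadow v t (e i) z * a' z)
           = (LINT z|\<mu>. (\<Sum>i<n. cnj (shadow v t (e i) z) * shadow v t (e i) z * a' z))"
          by (intro Bochner_Integration.integral_sum[symmetric] int(1)) auto
        also have "\<dots> = (LINT z|\<mu>. a z)"
        proof (rule Bochner_Integration.integral_cong[OF refl])
          fix z
          show "(\<Sum>i<n. cnj (shadow v t (e i) z) * shadow v t (e i) z * a' z) = a z"
          proof (cases "z \<in> K")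
            case True
            then have z: "z \<in> N" "z \<in> N2" using K N by auto
            have "(\<Sum>i<n. cnj (shadow v t (e i) z) * shadow v t (e i) z)
                = complex_of_real ((norm (C z (v z)))\<^sup>2)"
              by (rule frame_sum[OF N(3) z(1) eN e(2)[OF z(2)] dim[OF z(2)] v])
            then show ?thesis
              unfolding sum_distrib_right[symmetric] using Cv0[OF z(1)] by (simp add: a'_def)
          qed (use a in \<open>simp add: a'_def cc_on_def\<close>)
        qed
        finally show ?thesis .
      qed
      ultimately have "(\<Sum>i<n. LINT z|\<mu>0. complex_of_real ((norm (v z))\<^sup>2) * cinner (e i z) (e i z) * a' z)
          = (LINT z|\<mu>. a z)"
        by (simp add: tendsto_const_iff)
      moreover have "(\<Sum>i<n. LINT z|\<mu>0. complex_of_real ((norm (v z))\<^sup>2) * cinner (e i z) (e i z) * a' z)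
          = (LINT z|\<mu>0. (\<Sum>i<n. complex_of_real ((norm (v z))\<^sup>2) * cinner (e i z) (e i z) * a' z))"
        by (intro Bochner_Integration.integral_sum[symmetric] int(2)) auto
      moreover have "\<dots> = (LINT z|\<mu>0. complex_of_real (dim_over_trace F0 F C z) * a z)"
      proof (rule Bochner_Integration.integral_cong[OF refl])
        fix z
        show "(\<Sum>i<n. complex_of_real ((norm (v z))\<^sup>2) * cinner (e i z) (e i z) * a' z)
            = complex_of_real (dim_over_trace F0 F C z) * a z"
        proof (cases "z \<in> K")
          case True
          then have z: "z \<in> N" "z \<in> N2" using K N by auto
          have "cinner (e i z) (e i z) = 1" if "i < n" for i
            using e(2)[OF z(2)] that by (simp add: orthonormal_family_def)
          then show ?thesis by (simp add: a'_def dot[OF z(1)])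
        qed (use a in \<open>simp add: a'_def cc_on_def\<close>)
      qed
      ultimately show "(LINT z|\<mu>0. complex_of_real (dim_over_trace F0 F C z) * a z) = (LINT z|\<mu>. a z)"
        by simp
    qed
  qed
qed

section \<open>The Radon-Nikodym derivative\<close>

lemma dim_over_trace_continuous: "continuous_on \<Lambda>0 (dim_over_trace F0 F C)"
proof -
  define \<V> where "\<V> = {N. open N \<and> N \<subseteq> \<Lambda>0 \<and> continuous_on N (dim_over_trace F0 F C)}"
  have "\<Union>\<V> = \<Lambda>0"
  proof (intro equalityI subsetI)
    fix l assume "l \<in> \<Lambda>0"
    then obtain N where "open N" "l \<in> N" "N \<subseteq> \<Lambda>0" "continuous_on N (dim_over_trace F0 F C)"
      by (rule local_density)
    then show "l \<in> \<Union>\<V>" by (auto simp: \<V>_def)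
  qed (auto simp: \<V>_def)
  moreover have "continuous_on (\<Union>\<V>) (dim_over_trace F0 F C)"
    by (rule continuous_on_open_Union) (auto simp: \<V>_def)
  ultimately show ?thesis by simp
qed

lemma restricted_measure_density:
  assumes lc: "locally_compact_space (euclidean :: 'l topology)"
    and sc: "second_countable (euclidean :: 'l topology)"
  shows "restrict_space \<mu> \<Lambda>0 = density \<mu>0 (\<lambda>l. ennreal (dim_over_trace F0 F C l))"
proof (rule density_eqI_local[OF lc sc open_base sets_\<mu>0 _ dim_over_trace_continuous dim_over_trace_nonneg])
  show "sets (restrict_space \<mu> \<Lambda>0) = sets (restrict_space borel \<Lambda>0)"
    using sets_\<mu> by (intro sets_restrict_space_cong) simp
  fix l assume "l \<in> \<Lambda>0"
  then obtain N where N: "open N" "l \<in> N" "N \<subseteq> \<Lambda>0" "emeasure \<mu>0 N < \<infinity>" "emeasure \<mu> N < \<infinity>"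
      "continuous_on N (dim_over_trace F0 F C)"
    and eq: "\<forall>K a. compact K \<longrightarrow> K \<subseteq> N \<longrightarrow> a \<in> cc_on K \<longrightarrow>
      (LINT z|\<mu>0. complex_of_real (dim_over_trace F0 F C z) * a z) = (LINT z|\<mu>. a z)"
    by (rule local_density)
  have \<Lambda>: "\<Lambda>0 \<inter> space \<mu> \<in> sets \<mu>" using open_base by (simp add: sets_\<mu>)
  have "emeasure (restrict_space \<mu> \<Lambda>0) N < \<infinity>"
    using N(5) emeasure_restrict_space[OF \<Lambda> N(3)] by simp
  moreover have "(LINT z|restrict_space \<mu> \<Lambda>0. a z) = (LINT z|\<mu>. a z)" if "K \<subseteq> N" "a \<in> cc_on K" for K a
  proof -
    have "indicator \<Lambda>0 z *\<^sub>R a z = a z" for z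
      using that N(3) by (cases "z \<in> \<Lambda>0") (auto simp: cc_on_def)
    then show ?thesis unfolding integral_restrict_space[OF \<Lambda>] by simp
  qed
  ultimately show "\<exists>N. open N \<and> l \<in> N \<and> N \<subseteq> \<Lambda>0 \<and> emeasure \<mu>0 N < \<infinity> \<and>
      emeasure (restrict_space \<mu> \<Lambda>0) N < \<infinity> \<and>
      (\<forall>K a. compact K \<longrightarrow> K \<subseteq> N \<longrightarrow> a \<in> cc_on K \<longrightarrow>
        (LINT z|\<mu>0. complex_of_real (dim_over_trace F0 F C z) * a z) = (LINT z|restrict_space \<mu> \<Lambda>0. a z))"
    using N eq by (intro exI[of _ N]) simp
qed

lemma sigma_finite_\<mu>0:
  assumes sc: "second_countable (euclidean :: 'l topology)"
  shows "sigma_finite_measure \<mu>0"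
proof
  define \<V> where "\<V> = {N. open N \<and> N \<subseteq> \<Lambda>0 \<and> emeasure \<mu>0 N < \<infinity>}"
  have V_open: "open N" if "N \<in> \<V>" for N using that by (simp add: \<V>_def)
  obtain \<W> where W: "countable \<W>" "\<W> \<subseteq> \<V>" "\<Union>\<W> = \<Union>\<V>"
    by (rule Lindelof_open[OF sc V_open])
  have "\<Union>\<V> = \<Lambda>0"
  proof (intro equalityI subsetI)
    fix l assume "l \<in> \<Lambda>0"
    then obtain N where "open N" "l \<in> N" "N \<subseteq> \<Lambda>0" "emeasure \<mu>0 N < \<infinity>"
      by (rule local_density)
    then show "l \<in> \<Union>\<V>" by (auto simp: \<V>_def)
  qed (auto simp: \<V>_def)
  then have "\<Union>\<W> = space \<mu>0"
    using W(3) sets_eq_imp_space_eq[OF sets_\<mu>0] by (simp add: space_restrict_space)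
  moreover have "N \<in> sets \<mu>0" if "N \<in> \<V>" for N
    using that by (auto simp: \<V>_def sets_\<mu>0 sets_restrict_space intro!: image_eqI[of _ _ N])
  then have "\<W> \<subseteq> sets \<mu>0" using W(2) by auto
  moreover have "\<forall>N\<in>\<W>. emeasure \<mu>0 N \<noteq> \<infinity>"
    using W(2) by (auto simp: \<V>_def)
  ultimately show "\<exists>A. countable A \<and> A \<subseteq> sets \<mu>0 \<and> \<Union>A = space \<mu>0 \<and> (\<forall>a\<in>A. emeasure \<mu>0 a \<noteq> \<infinity>)"
    using W(1) by blast
qed

lemma dim_over_trace_measurable:
  "(\<lambda>l. ennreal (dim_over_trace F0 F C l)) \<in> borel_measurable \<mu>0"
proof -
  have "dim_over_trace F0 F C \<in> borel_measurable \<mu>0"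
    using borel_measurable_continuous_on_restrict[OF dim_over_trace_continuous]
      measurable_cong_sets[OF sets_\<mu>0] by blast
  then show ?thesis by measurable
qed

end

theorem theorem2p14:
  fixes \<pi>0 :: "('l::t2_space \<Rightarrow> complex) \<Rightarrow> 'h0::complex_hilbert \<Rightarrow> 'h0"
    and \<pi> :: "('l \<Rightarrow> complex) \<Rightarrow> 'h::complex_hilbert \<Rightarrow> 'h"
    and U :: "real \<Rightarrow> 'h0 \<Rightarrow> 'h0"
    and W :: "'h0 \<Rightarrow> 'h"
    and \<Lambda>0 :: "'l set"
    and F0 :: "'l \<Rightarrow> 'f::complex_inner set"
    and \<Gamma>0 :: "('l \<Rightarrow> 'f) set"
    and D0 :: "'h0 set"
    and s0 :: "'h0 \<Rightarrow> 'l \<Rightarrow> 'f"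
    and \<mu>0 :: "'l measure"
    and Ufib :: "real \<Rightarrow> 'l \<Rightarrow> 'f \<Rightarrow> 'f"
    and F :: "'l \<Rightarrow> 'g::complex_inner set"
    and \<Gamma> :: "('l \<Rightarrow> 'g) set"
    and D :: "'h set"
    and s :: "'h \<Rightarrow> 'l \<Rightarrow> 'g"
    and \<mu> :: "'l measure"
    and C :: "'l \<Rightarrow> 'g \<Rightarrow> 'f"
  assumes "locally_compact_space (euclidean :: 'l topology)"
    and "separable_C0 TYPE('l)"
    and "separable_space (euclidean :: 'h0 topology)"
    and "separable_space (euclidean :: 'h topology)"
    and "representation_C0 \<pi>0" and "nondegenerate \<pi>0"
    and "representation_C0 \<pi>" and "nondegenerate \<pi>"
    and "asymptotically_contained_via \<pi>0 \<pi> U W"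
    and "assumption_A \<pi>0 \<Lambda>0 F0 \<Gamma>0 D0 s0 \<mu>0"
    and "assumption_B \<Lambda>0 F0 \<Gamma>0 D0 s0 U Ufib"
    and "assumption_C \<pi> F \<Gamma> D s \<mu> D0 U W"
    and "assumption_D \<Lambda>0 F0 \<Gamma>0 D0 s0 F \<Gamma> s U W C"
  shows "absolutely_continuous \<mu>0 (restrict_space \<mu> \<Lambda>0) \<and>
    (\<lambda>l. ennreal (dim_over_trace F0 F C l)) \<in> borel_measurable \<mu>0 \<and>
    restrict_space \<mu> \<Lambda>0 = density \<mu>0 (\<lambda>l. ennreal (dim_over_trace F0 F C l)) \<and>
    (AE l in \<mu>0. RN_deriv \<mu>0 (restrict_space \<mu> \<Lambda>0) l = ennreal (dim_over_trace F0 F C l))"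
proof -
  interpret asymptotic_spectral_model \<pi>0 \<pi> U W \<Lambda>0 F0 \<Gamma>0 D0 s0 \<mu>0 Ufib F \<Gamma> D s \<mu> C
    using assms by unfold_locales
  have sc: "second_countable (euclidean :: 'l topology)"
    by (rule separable_C0_imp_second_countable) fact+
  interpret sigma_finite_measure \<mu>0 by (rule sigma_finite_\<mu>0[OF sc])
  note meas = dim_over_trace_measurable
  have dens: "restrict_space \<mu> \<Lambda>0 = density \<mu>0 (\<lambda>l. ennreal (dim_over_trace F0 F C l))"
    by (rule restricted_measure_density[OF _ sc]) fact
  have "absolutely_continuous \<mu>0 (restrict_space \<mu> \<Lambda>0)"
    unfolding dens by (rule absolutely_continuousI_density[OF meas])
  moreover have "AE l in \<mu>0. RN_deriv \<mu>0 (restrict_space \<mu> \<Lambda>0) l = ennreal (dim_over_trace F0 F C l)"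
    using RN_deriv_unique[OF meas dens[symmetric]] by eventually_elim simp
  ultimately show ?thesis using meas dens by blast
qed

end
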